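(* Suppose $2^{\aleph_0} > \aleph_1 = \mathrm{cf}(2^{\aleph_0})$ and $\mathrm{Cov}(\mathrm{meagre}) = 2^{\aleph_0}$. If $\mathbf{M}, \mathbf{N}$ are structures of size $\aleph_1$ in the same countable first-order language and $\mathbf{M} \equiv \mathbf{N}$, then $\mathbf{M}^{\omega}/\mathcal{U} \simeq \mathbf{N}^{\omega}/\mathcal{U}$ for some ultrafilter $\mathcal{U}$ on $\omega$.
   Context: The ambient theory is ZFC. $\mathrm{Cov}(\mathrm{meagre})$ is the minimal size of a family of meagre subsets of the real line whose union is the whole real line. $\mathrm{cf}$ denotes cofinality. The size of a structure is the cardinality of its universe. $\mathbf{M} \equiv \mathbf{N}$ denotes elementary equivalence, $\mathbf{M}^{\omega}/\mathcal{U}$ denotes the ultrapower of $\mathbf{M}$ by the ultrafilter $\mathcal{U}$ on $\omega$, and $\simeq$ denotes isomorphism of structures. *)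

theory Defs
  imports "HOL-Analysis.Analysis"
begin

unbundle cardinal_syntax

section \<open>Cardinal invariants\<close>

text \<open>The least cardinality of a member of the family \<open>\<F>\<close>, as a cardinal order.  It is meaningful
  only for nonempty \<open>\<F>\<close>, and is then determined up to \<open>=o\<close>; see \<open>min_card_iff\<close>.\<close>

definition min_card :: "'a set set \<Rightarrow> 'a rel" where
  "min_card \<F> = (SOME r. r \<in> card_of ` \<F> \<and> (\<forall>r' \<in> card_of ` \<F>. r \<le>o r'))"

text \<open>The library's \<^const>\<open>cofinal\<close> asks for strict upper bounds, which for infinite cardinals
  (the only ones used below) gives the same cofinality as non-strict bounds.\<close>

definition cofinality :: "'a rel \<Rightarrow> 'a rel" where
  "cofinality r = min_card {A. A \<subseteq> Field r \<and> cofinal A r}"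

abbreviation aleph1 :: "nat set rel" where
  "aleph1 \<equiv> cardSuc natLeq"

abbreviation continuum :: "(nat \<Rightarrow> bool) rel" where
  "continuum \<equiv> BNF_Cardinal_Arithmetic.cexp BNF_Cardinal_Arithmetic.ctwo natLeq"

definition nowhere_dense :: "'a::topological_space set \<Rightarrow> bool" where
  "nowhere_dense S \<longleftrightarrow> interior (closure S) = {}"

definition meagre :: "'a::topological_space set \<Rightarrow> bool" where
  "meagre S \<longleftrightarrow> (\<exists>A :: nat \<Rightarrow> 'a set. (\<forall>n. nowhere_dense (A n)) \<and> S = (\<Union>n. A n))"

definition cov_meagre :: "real set rel" where
  "cov_meagre = min_card {\<F>. (\<forall>S \<in> \<F>. meagre S) \<and> \<Union>\<F> = UNIV}"


section \<open>First-order languages and structures\<close>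

text \<open>Symbols form sets rather than whole types, so that a language may lack function symbols or
  relation symbols.  Constants are function symbols of arity 0.\<close>

record ('f, 'r) language =
  funs :: "'f set"
  rels :: "'r set"
  fun_ar :: "'f \<Rightarrow> nat"
  rel_ar :: "'r \<Rightarrow> nat"

definition countable_language :: "('f, 'r) language \<Rightarrow> bool" where
  "countable_language L \<longleftrightarrow> countable (funs L) \<and> countable (rels L)"

record ('f, 'r, 'a) fo_structure =
  universe :: "'a set"
  fun_int :: "'f \<Rightarrow> 'a list \<Rightarrow> 'a"
  rel_int :: "'r \<Rightarrow> 'a list \<Rightarrow> bool"

definition is_structure :: "('f, 'r) language \<Rightarrow> ('f, 'r, 'a) fo_structure \<Rightarrow> bool" where
  "is_structure L M \<longleftrightarrow> universe M \<noteq> {} \<and>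
     (\<forall>f \<in> funs L. \<forall>xs. length xs = fun_ar L f \<and> set xs \<subseteq> universe M \<longrightarrow> fun_int M f xs \<in> universe M)"

datatype 'f fo_term = Var nat | Fun 'f "'f fo_term list"

datatype ('f, 'r) formula =
    Eq "'f fo_term" "'f fo_term"
  | Rel 'r "'f fo_term list"
  | Neg "('f, 'r) formula"
  | Conj "('f, 'r) formula" "('f, 'r) formula"
  | Exi nat "('f, 'r) formula"

fun wf_term :: "('f, 'r) language \<Rightarrow> 'f fo_term \<Rightarrow> bool" where
  "wf_term L (Var x) \<longleftrightarrow> True"
| "wf_term L (Fun f ts) \<longleftrightarrow> f \<in> funs L \<and> length ts = fun_ar L f \<and> (\<forall>t \<in> set ts. wf_term L t)"

fun wf_formula :: "('f, 'r) language \<Rightarrow> ('f, 'r) formula \<Rightarrow> bool" where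
  "wf_formula L (Eq s t) \<longleftrightarrow> wf_term L s \<and> wf_term L t"
| "wf_formula L (Rel r ts) \<longleftrightarrow> r \<in> rels L \<and> length ts = rel_ar L r \<and> (\<forall>t \<in> set ts. wf_term L t)"
| "wf_formula L (Neg \<phi>) \<longleftrightarrow> wf_formula L \<phi>"
| "wf_formula L (Conj \<phi> \<psi>) \<longleftrightarrow> wf_formula L \<phi> \<and> wf_formula L \<psi>"
| "wf_formula L (Exi x \<phi>) \<longleftrightarrow> wf_formula L \<phi>"

fun fv_term :: "'f fo_term \<Rightarrow> nat set" where
  "fv_term (Var x) = {x}"
| "fv_term (Fun f ts) = (\<Union>t \<in> set ts. fv_term t)"

fun fv :: "('f, 'r) formula \<Rightarrow> nat set" where
  "fv (Eq s t) = fv_term s \<union> fv_term t"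
| "fv (Rel r ts) = (\<Union>t \<in> set ts. fv_term t)"
| "fv (Neg \<phi>) = fv \<phi>"
| "fv (Conj \<phi> \<psi>) = fv \<phi> \<union> fv \<psi>"
| "fv (Exi x \<phi>) = fv \<phi> - {x}"

definition sentence :: "('f, 'r) language \<Rightarrow> ('f, 'r) formula \<Rightarrow> bool" where
  "sentence L \<phi> \<longleftrightarrow> wf_formula L \<phi> \<and> fv \<phi> = {}"

fun val :: "('f, 'r, 'a) fo_structure \<Rightarrow> (nat \<Rightarrow> 'a) \<Rightarrow> 'f fo_term \<Rightarrow> 'a" where
  "val M v (Var x) = v x"
| "val M v (Fun f ts) = fun_int M f (map (val M v) ts)"

fun sat :: "('f, 'r, 'a) fo_structure \<Rightarrow> (nat \<Rightarrow> 'a) \<Rightarrow> ('f, 'r) formula \<Rightarrow> bool" where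
  "sat M v (Eq s t) \<longleftrightarrow> val M v s = val M v t"
| "sat M v (Rel r ts) \<longleftrightarrow> rel_int M r (map (val M v) ts)"
| "sat M v (Neg \<phi>) \<longleftrightarrow> \<not> sat M v \<phi>"
| "sat M v (Conj \<phi> \<psi>) \<longleftrightarrow> sat M v \<phi> \<and> sat M v \<psi>"
| "sat M v (Exi x \<phi>) \<longleftrightarrow> (\<exists>a \<in> universe M. sat M (v(x := a)) \<phi>)"

definition models :: "('f, 'r, 'a) fo_structure \<Rightarrow> ('f, 'r) formula \<Rightarrow> bool" where
  "models M \<phi> \<longleftrightarrow> (\<forall>v. range v \<subseteq> universe M \<longrightarrow> sat M v \<phi>)"

definition elem_equiv ::
  "('f, 'r) language \<Rightarrow> ('f, 'r, 'a) fo_structure \<Rightarrow> ('f, 'r, 'b) fo_structure \<Rightarrow> bool" where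
  "elem_equiv L M N \<longleftrightarrow> (\<forall>\<phi>. sentence L \<phi> \<longrightarrow> (models M \<phi> \<longleftrightarrow> models N \<phi>))"

definition isomorphic ::
  "('f, 'r) language \<Rightarrow> ('f, 'r, 'a) fo_structure \<Rightarrow> ('f, 'r, 'b) fo_structure \<Rightarrow> bool" where
  "isomorphic L M N \<longleftrightarrow> (\<exists>h. bij_betw h (universe M) (universe N) \<and>
     (\<forall>f \<in> funs L. \<forall>xs. length xs = fun_ar L f \<and> set xs \<subseteq> universe M \<longrightarrow>
        h (fun_int M f xs) = fun_int N f (map h xs)) \<and>
     (\<forall>r \<in> rels L. \<forall>xs. length xs = rel_ar L r \<and> set xs \<subseteq> universe M \<longrightarrow>
        (rel_int M r xs \<longleftrightarrow> rel_int N r (map h xs))))"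


section \<open>Ultrafilters and ultrapowers\<close>

text \<open>A set \<open>X\<close> belongs to the filter \<open>U\<close> iff \<open>eventually (\<lambda>i. i \<in> X) U\<close>.\<close>

definition ultrafilter :: "'i filter \<Rightarrow> bool" where
  "ultrafilter U \<longleftrightarrow> U \<noteq> bot \<and> (\<forall>P. eventually P U \<or> eventually (\<lambda>i. \<not> P i) U)"

definition ultrapower_rel :: "'i filter \<Rightarrow> 'a set \<Rightarrow> ('i \<Rightarrow> 'a) rel" where
  "ultrapower_rel U A = {(g, h). g \<in> UNIV \<rightarrow> A \<and> h \<in> UNIV \<rightarrow> A \<and> eventually (\<lambda>i. g i = h i) U}"

text \<open>Operations are applied to classes through arbitrary representatives \<open>gs\<close>;
  \<open>fun_int_ultrapower\<close> and \<open>rel_int_ultrapower\<close> show that their choice does not matter.\<close>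

definition ultrapower ::
  "'i filter \<Rightarrow> ('f, 'r, 'a) fo_structure \<Rightarrow> ('f, 'r, ('i \<Rightarrow> 'a) set) fo_structure" where
  "ultrapower U M = \<lparr>
     universe = (UNIV \<rightarrow> universe M) // ultrapower_rel U (universe M),
     fun_int = (\<lambda>f Xs. \<Union>gs \<in> {gs. list_all2 (\<in>) gs Xs}.
        ultrapower_rel U (universe M) `` {\<lambda>i. fun_int M f (map (\<lambda>g. g i) gs)}),
     rel_int = (\<lambda>r Xs. \<exists>gs. list_all2 (\<in>) gs Xs \<and>
        eventually (\<lambda>i. rel_int M r (map (\<lambda>g. g i) gs)) U)\<rparr>"


section \<open>Well-definedness\<close>

lemma min_card_iff:
  assumes "\<F> \<noteq> {}" and "Card_order r"
  shows "min_card \<F> =o r \<longleftrightarrow> (\<exists>A \<in> \<F>. |A| =o r) \<and> (\<forall>A \<in> \<F>. r \<le>o |A| )"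
proof -
  have "\<exists>r \<in> card_of ` \<F>. \<forall>r' \<in> card_of ` \<F>. r \<le>o r'"
    by (rule exists_minim_Card_order) (use assms card_of_Card_order in auto)
  then have *: "min_card \<F> \<in> card_of ` \<F> \<and> (\<forall>r' \<in> card_of ` \<F>. min_card \<F> \<le>o r')"
    unfolding min_card_def Bex_def by (rule someI_ex)
  then obtain A where A: "A \<in> \<F>" "min_card \<F> = |A|" by auto
  show ?thesis
  proof
    assume eq: "min_card \<F> =o r"
    then show "(\<exists>A \<in> \<F>. |A| =o r) \<and> (\<forall>A \<in> \<F>. r \<le>o |A| )"
      using A * ordIso_ordLeq_trans[OF ordIso_symmetric[OF eq]] by auto
  next
    assume R: "(\<exists>A \<in> \<F>. |A| =o r) \<and> (\<forall>A \<in> \<F>. r \<le>o |A| )"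
    then obtain B where B: "B \<in> \<F>" "|B| =o r" by auto
    have "min_card \<F> \<le>o r"
      using * B ordLeq_ordIso_trans by blast
    moreover have "r \<le>o min_card \<F>" using R A by simp
    ultimately show "min_card \<F> =o r" by (simp add: ordIso_iff_ordLeq)
  qed
qed

lemma equiv_ultrapower_rel: "equiv (UNIV \<rightarrow> A) (ultrapower_rel U A)"
  by (rule equivI)
    (auto simp: ultrapower_rel_def refl_on_def sym_on_def trans_on_def eq_commute
      elim: eventually_elim2)

lemma eventually_map_representatives:
  assumes "list_all2 (\<in>) gs (map (\<lambda>g. ultrapower_rel U A `` {g}) hs)"
  shows "eventually (\<lambda>i. map (\<lambda>g. g i) gs = map (\<lambda>h. h i) hs) U"
  using assms
proof (induction hs arbitrary: gs)
  case (Cons h hs)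
  then obtain g gs' where gs: "gs = g # gs'" "(h, g) \<in> ultrapower_rel U A"
    "list_all2 (\<in>) gs' (map (\<lambda>g. ultrapower_rel U A `` {g}) hs)"
    by (auto simp: list_all2_Cons2)
  have "eventually (\<lambda>i. h i = g i) U" using gs(2) by (simp add: ultrapower_rel_def)
  with Cons.IH[OF gs(3)] show ?case unfolding gs(1) by eventually_elim auto
qed simp

lemma representatives_refl:
  assumes "set hs \<subseteq> UNIV \<rightarrow> A"
  shows "list_all2 (\<in>) hs (map (\<lambda>g. ultrapower_rel U A `` {g}) hs)"
  using assms by (auto simp: list_all2_conv_all_nth ultrapower_rel_def Pi_def dest!: nth_mem)

lemma fun_int_pointwise:
  assumes "is_structure L M" "f \<in> funs L" "length hs = fun_ar L f" "set hs \<subseteq> UNIV \<rightarrow> universe M"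
  shows "(\<lambda>i. fun_int M f (map (\<lambda>h. h i) hs)) \<in> UNIV \<rightarrow> universe M"
proof
  fix i
  have "set (map (\<lambda>h. h i) hs) \<subseteq> universe M" using assms(4) by auto
  then show "fun_int M f (map (\<lambda>h. h i) hs) \<in> universe M"
    using assms(1-3) by (simp add: is_structure_def)
qed

lemma fun_int_ultrapower:
  assumes "is_structure L M" "f \<in> funs L" "length hs = fun_ar L f" "set hs \<subseteq> UNIV \<rightarrow> universe M"
  shows "fun_int (ultrapower U M) f (map (\<lambda>h. ultrapower_rel U (universe M) `` {h}) hs) =
    ultrapower_rel U (universe M) `` {\<lambda>i. fun_int M f (map (\<lambda>h. h i) hs)}" (is "?l = ?r")
proof
  let ?E = "ultrapower_rel U (universe M)"
  have cl: "(\<lambda>i. fun_int M f (map (\<lambda>h. h i) hs)) \<in> UNIV \<rightarrow> universe M"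
    by (rule fun_int_pointwise[OF assms])
  show "?r \<subseteq> ?l"
    using representatives_refl[OF assms(4), of U] by (auto simp: ultrapower_def)
  show "?l \<subseteq> ?r"
  proof
    fix k assume "k \<in> ?l"
    then obtain gs where gs: "list_all2 (\<in>) gs (map (\<lambda>h. ?E `` {h}) hs)"
      and k: "(\<lambda>i. fun_int M f (map (\<lambda>g. g i) gs), k) \<in> ?E"
      by (auto simp: ultrapower_def)
    have "eventually (\<lambda>i. fun_int M f (map (\<lambda>g. g i) gs) = k i) U"
      using k by (simp add: ultrapower_rel_def)
    with eventually_map_representatives[OF gs]
    have "eventually (\<lambda>i. fun_int M f (map (\<lambda>h. h i) hs) = k i) U"
      by eventually_elim simp
    then show "k \<in> ?r" using k cl by (simp add: ultrapower_rel_def)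
  qed
qed

lemma rel_int_ultrapower:
  assumes "set hs \<subseteq> UNIV \<rightarrow> universe M"
  shows "rel_int (ultrapower U M) r (map (\<lambda>h. ultrapower_rel U (universe M) `` {h}) hs) \<longleftrightarrow>
    eventually (\<lambda>i. rel_int M r (map (\<lambda>h. h i) hs)) U" (is "?l \<longleftrightarrow> ?r")
proof
  assume ?r
  then show ?l using representatives_refl[OF assms, of U] by (auto simp: ultrapower_def)
next
  assume ?l
  then obtain gs where gs: "list_all2 (\<in>) gs (map (\<lambda>h. ultrapower_rel U (universe M) `` {h}) hs)"
    and r: "eventually (\<lambda>i. rel_int M r (map (\<lambda>g. g i) gs)) U"
    by (auto simp: ultrapower_def)
  from eventually_map_representatives[OF gs] r show ?r by eventually_elim simp
qed

lemma is_structure_ultrapower: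
  assumes "is_structure L M"
  shows "is_structure L (ultrapower U M)"
proof -
  let ?E = "ultrapower_rel U (universe M)"
  have "fun_int (ultrapower U M) f Xs \<in> universe (ultrapower U M)"
    if f: "f \<in> funs L" and len: "length Xs = fun_ar L f" and Xs: "set Xs \<subseteq> universe (ultrapower U M)"
    for f Xs
  proof -
    have "\<forall>X \<in> set Xs. \<exists>h. h \<in> UNIV \<rightarrow> universe M \<and> X = ?E `` {h}"
      using Xs by (auto simp: ultrapower_def quotient_def)
    then obtain h where h: "\<And>X. X \<in> set Xs \<Longrightarrow> h X \<in> UNIV \<rightarrow> universe M \<and> X = ?E `` {h X}"
      by metis
    let ?hs = "map h Xs"
    have Xs_eq: "Xs = map (\<lambda>h. ?E `` {h}) ?hs" using h by (auto intro: nth_equalityI)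
    have hs: "length ?hs = fun_ar L f" "set ?hs \<subseteq> UNIV \<rightarrow> universe M" using len h by auto
    show ?thesis
      using fun_int_pointwise[OF assms f hs] fun_int_ultrapower[OF assms f hs, of U] unfolding Xs_eq[symmetric]
      by (simp add: ultrapower_def quotientI)
  qed
  moreover have "universe (ultrapower U M) \<noteq> {}"
    using assms by (auto simp: ultrapower_def is_structure_def quotient_def Pi_eq_empty)
  ultimately show ?thesis by (auto simp: is_structure_def)
qed

end

theory Submission
  imports Defs
begin

text \<open>
  Write \<open>M\<close> and \<open>N\<close> as increasing unions of countable elementary substructures \<open>M\<^sub>i\<close> and \<open>N\<^sub>i\<close>
  for \<open>i < \<omega>\<^sub>1\<close>, so that each sequence in \<open>M\<close> lies in some \<open>M\<^sub>i\<close>.  A back-and-forth construction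
  produces pairs \<open>(f, g)\<close> of sequences such that any finitely many formulas about any finitely many
  pairs hold of the \<open>f(i)\<close> in \<open>M\<close> iff they hold of the \<open>g(i)\<close> in \<open>N\<close>, for infinitely many \<open>i\<close>.
  Every ultrafilter that contains these sets of indices makes \<open>[f] \<mapsto> [g]\<close> an isomorphism.

  Given fewer than \<open>2\<^bsup>\<aleph>\<^sub>0\<^esup>\<close> pairs with values in \<open>M\<^sub>i\<close> and \<open>N\<^sub>i\<close>, and a sequence \<open>f\<close> in \<open>M\<^sub>i\<close>, a
  Cohen-generic \<open>g\<close> in \<open>N\<^sub>i\<close> is a suitable partner: each requirement excludes only a meagre set, and
  \<open>Cov(meagre) = 2\<^bsup>\<aleph>\<^sub>0\<^esup>\<close>.  Countability of \<open>N\<^sub>i\<close> is essential here.  The cofinality assumption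
  permits treating the \<open>2\<^bsup>\<aleph>\<^sub>0\<^esup>\<close> sequences in \<open>\<omega>\<^sub>1\<close> consecutive blocks, each with fewer than
  \<open>2\<^bsup>\<aleph>\<^sub>0\<^esup>\<close> tasks, the \<open>i\<close>-th block staying within \<open>M\<^sub>i\<close> and \<open>N\<^sub>i\<close>.
\<close>

section \<open>Formulas\<close>

lemma finite_fv_term: "finite (fv_term t)"
  by (induction t) auto

lemma finite_fv: "finite (fv \<phi>)"
  by (induction \<phi>) (auto simp: finite_fv_term)

lemma val_cong:
  assumes "\<And>x. x \<in> fv_term t \<Longrightarrow> v x = w x"
  shows "val M v t = val M w t"
  using assms
proof (induction t)
  case (Fun f ts)
  then have "map (val M v) ts = map (val M w) ts" by auto
  then show ?case by (simp only: val.simps)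
qed simp

lemma sat_cong:
  assumes "\<And>x. x \<in> fv \<phi> \<Longrightarrow> v x = w x"
  shows "sat M v \<phi> = sat M w \<phi>"
  using assms
proof (induction \<phi> arbitrary: v w)
  case (Eq s t)
  then show ?case using val_cong[of s v w M] val_cong[of t v w M] by simp
next
  case (Rel r ts)
  then have "map (val M v) ts = map (val M w) ts" by (auto intro: val_cong)
  then show ?case by (simp only: sat.simps)
next
  case (Neg \<phi>)
  have "sat M v \<phi> = sat M w \<phi>"
    by (rule Neg.IH) (use Neg.prems in simp)
  then show ?case by (simp only: sat.simps)
next
  case (Conj \<phi> \<psi>)
  have "sat M v \<phi> = sat M w \<phi>" "sat M v \<psi> = sat M w \<psi>"
    by (rule Conj.IH(1), use Conj.prems in simp) (rule Conj.IH(2), use Conj.prems in simp)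
  then show ?case by (simp only: sat.simps)
next
  case (Exi x \<phi>)
  have "sat M (v(x := a)) \<phi> = sat M (w(x := a)) \<phi>" for a
    by (rule Exi.IH) (use Exi.prems in auto)
  then show ?case by simp
qed

section \<open>Renaming of variables in terms and atomic formulas\<close>

fun ren_term :: "(nat \<Rightarrow> nat) \<Rightarrow> 'f fo_term \<Rightarrow> 'f fo_term" where
  "ren_term \<rho> (Var x) = Var (\<rho> x)"
| "ren_term \<rho> (Fun f ts) = Fun f (map (ren_term \<rho>) ts)"

lemma val_ren_term: "val M v (ren_term \<rho> t) = val M (\<lambda>x. v (\<rho> x)) t"
proof (induction t)
  case (Fun f ts)
  then have "map (val M v) (map (ren_term \<rho>) ts) = map (val M (\<lambda>x. v (\<rho> x))) ts" by simp
  then show ?case by (simp only: ren_term.simps val.simps)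
qed simp

lemma wf_ren_term: "wf_term L t \<Longrightarrow> wf_term L (ren_term \<rho> t)"
  by (induction t) auto

lemma fv_ren_term: "fv_term (ren_term \<rho> t) = \<rho> ` fv_term t"
  by (induction t) auto

text \<open>Restricting to atomic formulas avoids any capture of bound variables; compound formulas
  are returned unchanged as a default.\<close>

fun ren_atom :: "(nat \<Rightarrow> nat) \<Rightarrow> ('f, 'r) formula \<Rightarrow> ('f, 'r) formula" where
  "ren_atom \<rho> (Eq s t) = Eq (ren_term \<rho> s) (ren_term \<rho> t)"
| "ren_atom \<rho> (Rel r ts) = Rel r (map (ren_term \<rho>) ts)"
| "ren_atom \<rho> \<phi> = \<phi>"

fun atomic :: "('f, 'r) formula \<Rightarrow> bool" where
  "atomic (Eq s t) = True"
| "atomic (Rel r ts) = True"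
| "atomic \<phi> = False"

lemma sat_ren_atom: "atomic \<phi> \<Longrightarrow> sat M v (ren_atom \<rho> \<phi>) = sat M (\<lambda>x. v (\<rho> x)) \<phi>"
  by (cases \<phi>) (simp_all add: val_ren_term comp_def)

lemma wf_ren_atom: "wf_formula L \<phi> \<Longrightarrow> wf_formula L (ren_atom \<rho> \<phi>)"
  by (cases \<phi>) (auto simp: wf_ren_term)

lemma fv_ren_atom: "atomic \<phi> \<Longrightarrow> fv (ren_atom \<rho> \<phi>) = \<rho> ` fv \<phi>"
  by (cases \<phi>) (auto simp: fv_ren_term)

text \<open>The base of the fold is a tautology, since the syntax has no truth constant. Its only
  variable \<open>k\<close> is the one quantified later, so it adds no free variable then.\<close>

definition conj_list :: "nat \<Rightarrow> ('f, 'r) formula list \<Rightarrow> ('f, 'r) formula" where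
  "conj_list k \<phi>s = foldr Conj \<phi>s (Eq (Var k) (Var k))"

lemma sat_conj_list: "sat M v (conj_list k \<phi>s) \<longleftrightarrow> (\<forall>\<phi> \<in> set \<phi>s. sat M v \<phi>)"
  by (induction \<phi>s) (auto simp: conj_list_def)

lemma wf_conj_list: "wf_formula L (conj_list k \<phi>s) \<longleftrightarrow> (\<forall>\<phi> \<in> set \<phi>s. wf_formula L \<phi>)"
  by (induction \<phi>s) (auto simp: conj_list_def)

lemma fv_conj_list: "fv (conj_list k \<phi>s) = insert k (\<Union>\<phi> \<in> set \<phi>s. fv \<phi>)"
  by (induction \<phi>s) (auto simp: conj_list_def)

text \<open>The types of symbols may be uncountable, so only well-formed terms are counted: by
  induction on a size bound, those of size below \<open>n + 1\<close> come from a symbol and a list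
  of terms of size below \<open>n\<close>.\<close>

lemma countable_wf_term:
  assumes "countable_language L"
  shows "countable {t. wf_term L t}"
proof -
  have "countable {t. wf_term L t \<and> size t < n}" for n
  proof (induction n)
    case (Suc n)
    have "{t. wf_term L t \<and> size t < Suc n} \<subseteq>
        range Var \<union> (\<lambda>(f, ts). Fun f ts) ` (funs L \<times> lists {t. wf_term L t \<and> size t < n})"
    proof
      fix t assume t: "t \<in> {t. wf_term L t \<and> size t < Suc n}"
      show "t \<in> range Var \<union> (\<lambda>(f, ts). Fun f ts) ` (funs L \<times> lists {t. wf_term L t \<and> size t < n})"
      proof (cases t)
        case (Fun f ts)
        have "size u < n" if "u \<in> set ts" for u
          using t Fun size_list_estimation'[OF that, of "size u" size] by auto
        then show ?thesis using t Fun by auto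
      qed auto
    qed
    moreover have "countable (range Var \<union>
        (\<lambda>(f, ts). Fun f ts) ` (funs L \<times> lists {t. wf_term L t \<and> size t < n}))"
      using Suc assms by (intro countable_Un countable_image countable_SIGMA countable_lists)
        (auto simp: countable_language_def)
    ultimately show ?case by (rule countable_subset)
  qed simp
  then have "countable (\<Union>n. {t. wf_term L t \<and> size t < n})" by blast
  then show ?thesis by (rule countable_subset[rotated]) auto
qed

lemma countable_wf_formula:
  fixes L :: "('f, 'r) language"
  assumes "countable_language L"
  shows "countable {\<phi>. wf_formula L \<phi>}"
proof -
  let ?T = "{t. wf_term L t}"
  have T: "countable ?T" by (rule countable_wf_term[OF assms])
  have "countable {\<phi>. wf_formula L \<phi> \<and> size \<phi> < n}" for n
  proof (induction n)
    case (Suc n)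
    let ?F = "{\<phi>. wf_formula L \<phi> \<and> size \<phi> < n}"
    let ?B = "(\<lambda>(s, t). Eq s t) ` (?T \<times> ?T) \<union> (\<lambda>(r, ts). Rel r ts) ` (rels L \<times> lists ?T) \<union>
      Neg ` ?F \<union> (\<lambda>(\<phi>, \<psi>). Conj \<phi> \<psi>) ` (?F \<times> ?F) \<union> (\<lambda>(x, \<phi>). Exi x \<phi>) ` (UNIV \<times> ?F)"
    have "{\<phi>. wf_formula L \<phi> \<and> size \<phi> < Suc n} \<subseteq> ?B"
    proof
      fix \<phi> :: "('f, 'r) formula" assume "\<phi> \<in> {\<phi>. wf_formula L \<phi> \<and> size \<phi> < Suc n}"
      then show "\<phi> \<in> ?B" by (cases \<phi>) (auto simp: image_iff)
    qed
    moreover have "countable ?B"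
      using Suc assms T
      by (intro countable_Un countable_image countable_SIGMA countable_lists)
        (auto simp: countable_language_def)
    ultimately show ?case by (rule countable_subset)
  qed simp
  then have "countable (\<Union>n. {\<phi>. wf_formula L \<phi> \<and> size \<phi> < n})" by blast
  then show ?thesis by (rule countable_subset[rotated]) auto
qed


section \<open>Countable elementary hulls\<close>

text \<open>The Tarski-Vaught criterion for \<open>H\<close>. Satisfaction is always evaluated in
  \<open>M\<close>, so \<open>H\<close> itself is never made into a structure.\<close>

definition witness_closed :: "('f, 'r) language \<Rightarrow> ('f, 'r, 'a) fo_structure \<Rightarrow> 'a set \<Rightarrow> bool" where
  "witness_closed L M H \<longleftrightarrow> (\<forall>\<phi> k v. wf_formula L \<phi> \<longrightarrow> v ` (fv \<phi> - {k}) \<subseteq> H \<longrightarrow>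
     sat M v (Exi k \<phi>) \<longrightarrow> (\<exists>a \<in> H. sat M (v(k := a)) \<phi>))"

text \<open>The list \<open>xs\<close> is a finite assignment to the variables other than \<open>k\<close>.\<close>

definition skolem :: "('f, 'r, 'a) fo_structure \<Rightarrow> ('f, 'r) formula \<times> nat \<times> (nat \<times> 'a) list \<Rightarrow> 'a" where
  "skolem M = (\<lambda>(\<phi>, k, xs). SOME a.
     a \<in> universe M \<and> ((\<exists>b \<in> universe M. sat M ((\<lambda>j. the (map_of xs j))(k := b)) \<phi>) \<longrightarrow>
       sat M ((\<lambda>j. the (map_of xs j))(k := a)) \<phi>))"

lemma skolem:
  assumes "is_structure L M"
  shows "skolem M (\<phi>, k, xs) \<in> universe M"
    and "b \<in> universe M \<Longrightarrow> sat M ((\<lambda>j. the (map_of xs j))(k := b)) \<phi> \<Longrightarrow>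
      sat M ((\<lambda>j. the (map_of xs j))(k := skolem M (\<phi>, k, xs))) \<phi>"
proof -
  have "\<exists>a. a \<in> universe M \<and> ((\<exists>b \<in> universe M. sat M ((\<lambda>j. the (map_of xs j))(k := b)) \<phi>) \<longrightarrow>
       sat M ((\<lambda>j. the (map_of xs j))(k := a)) \<phi>)"
    using assms unfolding is_structure_def by blast
  note someI_ex[OF this]
  then show "skolem M (\<phi>, k, xs) \<in> universe M"
    and "b \<in> universe M \<Longrightarrow> sat M ((\<lambda>j. the (map_of xs j))(k := b)) \<phi> \<Longrightarrow>
      sat M ((\<lambda>j. the (map_of xs j))(k := skolem M (\<phi>, k, xs))) \<phi>"
    unfolding skolem_def prod.case by blast+
qed

inductive_set skolem_hull :: "('f, 'r) language \<Rightarrow> ('f, 'r, 'a) fo_structure \<Rightarrow> 'a set \<Rightarrow> 'a set"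
  for L M X where
  base: "x \<in> X \<Longrightarrow> x \<in> skolem_hull L M X"
| step: "wf_formula L \<phi> \<Longrightarrow> \<forall>p \<in> set xs. snd p \<in> skolem_hull L M X \<Longrightarrow>
    skolem M (\<phi>, k, xs) \<in> skolem_hull L M X"

lemma skolem_hull_mono: "X \<subseteq> Y \<Longrightarrow> skolem_hull L M X \<subseteq> skolem_hull L M Y"
proof
  fix x assume "X \<subseteq> Y" "x \<in> skolem_hull L M X"
  from this(2,1) show "x \<in> skolem_hull L M Y"
    by (induction rule: skolem_hull.induct) (auto intro: skolem_hull.intros)
qed

lemma skolem_hull_subset:
  assumes "is_structure L M" "X \<subseteq> universe M"
  shows "skolem_hull L M X \<subseteq> universe M"
proof
  fix x assume "x \<in> skolem_hull L M X"
  then show "x \<in> universe M"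
    by induction (use assms skolem(1) in auto)
qed

text \<open>The hull is exhausted by \<omega> stages \<open>K n\<close>, each countable because
  there are countably many formulas and finite lists of parameters. The finitely many parameters of
  a step lie in a common stage.\<close>

lemma countable_skolem_hull:
  assumes "countable_language L" "countable X"
  shows "countable (skolem_hull L M X)"
proof -
  define K where "K = rec_nat X
    (\<lambda>_ H. H \<union> skolem M ` ({\<phi>. wf_formula L \<phi>} \<times> UNIV \<times> lists (UNIV \<times> H)))"
  have K: "K 0 = X"
    "K (Suc n) = K n \<union> skolem M ` ({\<phi>. wf_formula L \<phi>} \<times> UNIV \<times> lists (UNIV \<times> K n))" for n
    by (auto simp: K_def)
  have mono: "mono K"
    by (rule monoI, erule lift_Suc_mono_le[rotated]) (auto simp: K)
  have "countable (K n)" for n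
    by (induction n) (use assms countable_wf_formula[OF assms(1)] in \<open>auto simp: K
      intro!: countable_image countable_SIGMA countable_lists\<close>)
  then have cou: "countable (\<Union>n. K n)" by blast
  have "x \<in> (\<Union>n. K n)" if "x \<in> skolem_hull L M X" for x
    using that
  proof induction
    case (base x)
    then show ?case using K(1) by blast
  next
    case (step \<phi> xs k)
    have "\<exists>n. \<forall>p \<in> set xs. snd p \<in> K n"
    proof -
      have "\<forall>p \<in> set xs. \<exists>n. snd p \<in> K n" using step by auto
      then obtain m where m: "\<forall>p \<in> set xs. snd p \<in> K (m p)" by metis
      have "snd p \<in> K (Max (m ` set xs))" if "p \<in> set xs" for p
        using m that monoD[OF mono, of "m p" "Max (m ` set xs)"] by auto
      then show ?thesis by blast
    qed
    then obtain n where "\<forall>p \<in> set xs. snd p \<in> K n" ..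
    then have "skolem M (\<phi>, k, xs) \<in> K (Suc n)"
      using step(1) unfolding K(2) by (intro UnI2 imageI) auto
    then show ?case by blast
  qed
  then show ?thesis using cou by (meson countable_subset subsetI)
qed

lemma witness_closed_skolem_hull:
  assumes "is_structure L M"
  shows "witness_closed L M (skolem_hull L M X)"
  unfolding witness_closed_def
proof (intro allI impI)
  fix \<phi> k v
  assume wf: "wf_formula L \<phi>" and v: "v ` (fv \<phi> - {k}) \<subseteq> skolem_hull L M X"
    and ex: "sat M v (Exi k \<phi>)"
  define xs where "xs = map (\<lambda>j. (j, v j)) (sorted_list_of_set (fv \<phi> - {k}))"
  have xs: "map_of xs j = Some (v j)" if "j \<in> fv \<phi>" "j \<noteq> k" for j
    using that finite_fv[of \<phi>] by (simp add: xs_def map_of_map_restrict)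
  \<comment> \<open>The list \<open>xs\<close> records \<open>v\<close> only on the free variables
    other than \<open>k\<close>; elsewhere the lookup has an arbitrary value, which does not affect
    satisfaction.\<close>
  have *: "sat M ((\<lambda>j. the (map_of xs j))(k := a)) \<phi> = sat M (v(k := a)) \<phi>" for a
    by (rule sat_cong) (auto simp: xs)
  obtain b where b: "b \<in> universe M" "sat M (v(k := b)) \<phi>" using ex by auto
  have "sat M (v(k := skolem M (\<phi>, k, xs))) \<phi>"
    using skolem(2)[OF assms b(1), of xs k \<phi>] b(2) * by simp
  moreover have "skolem M (\<phi>, k, xs) \<in> skolem_hull L M X"
    by (rule skolem_hull.step[OF wf]) (use v finite_fv[of \<phi>] in \<open>auto simp: xs_def\<close>)
  ultimately show "\<exists>a \<in> skolem_hull L M X. sat M (v(k := a)) \<phi>" by blast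
qed

section \<open>Generic sequences from the covering number\<close>

text \<open>An open interval that misses \<open>S\<close> also misses the closure of
  \<open>S\<close>, so no ball can lie in that closure.\<close>

lemma nowhere_denseI:
  fixes S :: "real set"
  assumes "\<And>a b. a < b \<Longrightarrow> \<exists>c d. a \<le> c \<and> c < d \<and> d \<le> b \<and> {c<..<d} \<inter> S = {}"
  shows "nowhere_dense S"
  unfolding nowhere_dense_def
proof (rule ccontr)
  assume "interior (closure S) \<noteq> {}"
  then obtain x where "x \<in> interior (closure S)" by blast
  then obtain e where e: "e > 0" "ball x e \<subseteq> closure S"
    by (meson mem_interior)
  have ball: "ball x e = {x - e<..<x + e}" by (auto simp: dist_real_def)
  obtain c d where cd: "x - e \<le> c" "c < d" "d \<le> x + e" "{c<..<d} \<inter> S = {}"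
    using assms[of "x - e" "x + e"] e(1) by auto
  have "{c<..<d} \<inter> closure S = {}"
    using cd(4) by (metis open_greaterThanLessThan open_Int_closure_eq_empty)
  moreover have "(c + d) / 2 \<in> {c<..<d}" using cd(2) by auto
  moreover have "{c<..<d} \<subseteq> closure S" using cd(1,3) e(2) unfolding ball by auto
  ultimately show False by blast
qed

text \<open>Reading \<open>i\<close>-th terms off a real number replaces the Baire space by the real line: any value of
  a late enough term can be forced by shrinking an interval, with no need to fix earlier terms.\<close>

definition code :: "real \<Rightarrow> nat \<Rightarrow> nat" where
  "code x i = nat \<lfloor>1 / frac (2 ^ i * x)\<rfloor> - 1"

text \<open>An interval of length at least \<open>2 / 2 ^ i\<close> contains a full period
  \<open>[m / 2 ^ i, (m + 1) / 2 ^ i]\<close>. Inside it the fractional part \<open>y\<close> of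
  \<open>2 ^ i * x\<close> runs through all of \<open>(0, 1)\<close>, and
  \<open>1 / (t + 2) < y < 1 / (t + 1)\<close> gives \<open>1 / y\<close> the floor
  \<open>t + 1\<close>; the subtraction in \<open>code\<close> shifts this to \<open>t\<close>, so
  that 0 is a value too.\<close>

lemma code_interval:
  fixes a b :: real
  assumes "2 / 2 ^ i \<le> b - a"
  shows "\<exists>c d. a \<le> c \<and> c < d \<and> d \<le> b \<and> (\<forall>x \<in> {c<..<d}. code x i = t)"
proof -
  define m where "m = \<lceil>2 ^ i * a\<rceil>"
  define c d where "c = (m + 1 / (t + 2)) / 2 ^ i" and "d = (m + 1 / (t + 1)) / 2 ^ i"
  have m: "2 ^ i * a \<le> m" "m < 2 ^ i * a + 1" by (auto simp: m_def) linarith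
  have b: "2 ^ i * b \<ge> 2 ^ i * a + 2" using assms by (simp add: field_simps)
  have "2 ^ i * a \<le> m + 1 / (real t + 2)"
    using m(1) by (rule order_trans) simp
  then have "a \<le> c" by (simp add: c_def pos_le_divide_eq algebra_simps)
  moreover have "c < d"
    unfolding c_def d_def by (intro divide_strict_right_mono add_strict_left_mono frac_less2) auto
  moreover have "d \<le> b"
  proof -
    have "1 / (real t + 1) \<le> 1" by simp
    then have "m + 1 / (real t + 1) \<le> 2 ^ i * b" using m(2) b by linarith
    then show ?thesis by (simp add: d_def pos_divide_le_eq algebra_simps)
  qed
  moreover have "code x i = t" if "x \<in> {c<..<d}" for x
  proof -
    define y where "y = 2 ^ i * x - m"
    have y: "1 / (real t + 2) < y" "y < 1 / (real t + 1)"
      using that by (auto simp: y_def c_def d_def pos_divide_less_eq pos_less_divide_eq algebra_simps)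
    have y01: "0 < y" "y < 1"
    proof -
      show "0 < y" using y(1) by (smt (verit) divide_nonneg_nonneg of_nat_0_le_iff)
      have "1 / (real t + 1) \<le> 1" by simp
      then show "y < 1" using y(2) by linarith
    qed
    have "\<lfloor>2 ^ i * x\<rfloor> = m" using y01 by (simp add: y_def floor_eq_iff)
    then have "frac (2 ^ i * x) = y" by (simp add: frac_def y_def)
    moreover have "\<lfloor>1 / y\<rfloor> = int t + 1"
      using y y01 by (auto simp: floor_eq_iff field_simps)
    ultimately show ?thesis by (simp add: code_def)
  qed
  ultimately show ?thesis by blast
qed

text \<open>Sort the exceptional \<open>x\<close> by a bound \<open>n\<close> from which on
  \<open>code x\<close> misses \<open>T\<close>. Each class is nowhere dense: inside any interval a
  late term can be forced into a nonempty \<open>T i\<close>.\<close>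

lemma meagre_code:
  assumes "infinite {i. T i \<noteq> {}}"
  shows "meagre {x. finite {i. code x i \<in> T i}}"
proof -
  define A where "A n = {x. \<forall>i \<ge> n. code x i \<notin> T i}" for n
  have "nowhere_dense (A n)" for n
  proof (rule nowhere_denseI)
    fix a b :: real assume "a < b"
    obtain k where k: "(1/2::real) ^ k < (b - a) / 2"
      using real_arch_pow_inv[of "(b - a) / 2" "1/2"] \<open>a < b\<close> by auto
    \<comment> \<open>\<open>i \<ge> k\<close> makes the interval long enough for the
      \<open>i\<close>-th term to be forced, and \<open>i \<ge> n\<close> makes a hit at
      \<open>i\<close> leave \<open>A n\<close>.\<close>
    obtain i where i: "i \<ge> max k n" "T i \<noteq> {}"
      using assms unfolding infinite_nat_iff_unbounded_le by blast
    then obtain t where t: "t \<in> T i" by blast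
    have "(1/2::real) ^ i \<le> (1/2) ^ k" using i by (intro power_decreasing) auto
    then have "(1/2::real) ^ i \<le> (b - a) / 2" using k by (meson le_less_trans less_imp_le)
    then have "2 * (1/2::real) ^ i \<le> 2 * ((b - a) / 2)" by (rule mult_left_mono) simp
    then have "2 / 2 ^ i \<le> b - a" by (simp add: power_one_over)
    from code_interval[OF this, of t] obtain c d where
      cd: "a \<le> c" "c < d" "d \<le> b" "\<forall>x \<in> {c<..<d}. code x i = t" by blast
    then have "{c<..<d} \<inter> A n = {}" using i t by (auto simp: A_def)
    then show "\<exists>c d. a \<le> c \<and> c < d \<and> d \<le> b \<and> {c<..<d} \<inter> A n = {}" using cd by blast
  qed
  moreover have "{x. finite {i. code x i \<in> T i}} = (\<Union>n. A n)"
  proof -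
    have "finite {i. code x i \<in> T i} \<longleftrightarrow> (\<exists>n. x \<in> A n)" for x
      unfolding finite_nat_set_iff_bounded A_def by (auto simp: not_le[symmetric])
    then show ?thesis by auto
  qed
  ultimately show ?thesis unfolding meagre_def by blast
qed

lemma Card_order_continuum: "Card_order continuum"
  by (rule Card_order_cexp)

lemma meagre_family_avoided:
  fixes A :: "'i \<Rightarrow> real set"
  assumes "cov_meagre =o continuum" and "|I| <o continuum" and "\<And>i. i \<in> I \<Longrightarrow> meagre (A i)"
  shows "\<exists>x. \<forall>i \<in> I. x \<notin> A i"
proof (rule ccontr)
  let ?F = "{\<F> :: real set set. (\<forall>S \<in> \<F>. meagre S) \<and> \<Union>\<F> = UNIV}"
  assume "\<not> ?thesis"
  then have "A ` I \<in> ?F" using assms(3) by auto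
  \<comment> \<open>The assumed cover also witnesses that the family of meagre covers is nonempty,
    as \<open>min_card_iff\<close> requires.\<close>
  moreover from this have "(\<forall>A \<in> ?F. continuum \<le>o |A| )"
    using min_card_iff[of ?F continuum] assms(1) Card_order_continuum
    unfolding cov_meagre_def by auto
  ultimately have "continuum \<le>o |A ` I|" by blast
  also have "|A ` I| \<le>o |I|" by (rule card_of_image)
  finally show False using assms(2) not_ordLess_ordLeq by blast
qed

section \<open>Extending partial maps by one generic sequence\<close>

lemma countable_ordLeq_Cinfinite:
  assumes "Cinfinite r" and "countable X"
  shows "|X| \<le>o r"
proof -
  have "|X| \<le>o |UNIV :: nat set|"
    using assms(2) by (auto simp: countable_def card_of_ordLeq[symmetric])
  then show ?thesis
    using assms(1) by (meson card_of_nat natLeq_ordLeq_cinfinite ordLeq_ordIso_trans ordLeq_transitive)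
qed

lemma card_of_lists_bound:
  assumes "Cinfinite r" and "|X| \<le>o r"
  shows "|lists X| \<le>o r"
proof -
  have "|{xs \<in> lists X. length xs = n}| \<le>o r" for n
  proof (induction n)
    case 0
    have "countable {xs \<in> lists X. length xs = 0}" by (rule countable_subset[of _ "{[]}"]) auto
    then show ?case by (rule countable_ordLeq_Cinfinite[OF assms(1)])
  next
    case (Suc n)
    have "{xs \<in> lists X. length xs = Suc n} \<subseteq>
        (\<lambda>(x, xs). x # xs) ` (X \<times> {xs \<in> lists X. length xs = n})"
      by (auto simp: length_Suc_conv image_iff)
    then have "|{xs \<in> lists X. length xs = Suc n}| \<le>o |X \<times> {xs \<in> lists X. length xs = n}|"
      by (meson card_of_image card_of_mono1 ordLeq_transitive)
    also have "|X \<times> {xs \<in> lists X. length xs = n}| \<le>o r"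
      using assms Suc by (intro card_of_Times_ordLeq_infinite_Field) (auto simp: cinfinite_def)
    finally show ?case .
  qed
  then have "|\<Union>n. {xs \<in> lists X. length xs = n}| \<le>o r"
    using assms(1) natLeq_ordLeq_cinfinite[OF assms(1)] card_of_nat
    by (intro UNION_Cinfinite_bound) (auto intro: ordIso_ordLeq_trans)
  moreover have "lists X = (\<Union>n. {xs \<in> lists X. length xs = n})" by auto
  ultimately show ?thesis by simp
qed

lemma continuum_eq: "continuum = |UNIV :: (nat \<Rightarrow> bool) set|"
  by (simp add: BNF_Cardinal_Arithmetic.cexp_def ctwo_def Field_natLeq Field_card_of Func_def)

lemma nat_less_continuum: "|UNIV :: nat set| <o continuum"
  using ordLess_ctwo_cexp[OF natLeq_Card_order] card_of_nat ordIso_ordLess_trans by blast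

text \<open>Adding a copy of the naturals yields an infinite cardinal still below the continuum, so
  the bounds for infinite cardinals become available even when \<open>X\<close> is finite.\<close>

lemma card_of_Plus_nat_less_continuum:
  assumes "|X| <o continuum"
  shows "|X <+> (UNIV :: nat set)| <o continuum"
proof -
  have "infinite (UNIV :: (nat \<Rightarrow> bool) set)"
    using nat_less_continuum unfolding continuum_eq
    by (meson card_of_ordLeq_infinite infinite_UNIV_nat ordLess_imp_ordLeq)
  then show ?thesis
    using assms nat_less_continuum unfolding continuum_eq by (rule card_of_Plus_ordLess_infinite)
qed

text \<open>Variables stand for pairs of sequences, and only their \<open>i\<close>-th entries are
  read. The ultrafilter will contain the sets of \<open>i\<close> at which atomic formulas
  agree.\<close>

definition agree :: "('f, 'r, 'a) fo_structure \<Rightarrow> ('f, 'r, 'b) fo_structure \<Rightarrow>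
    (nat \<Rightarrow> (nat \<Rightarrow> 'a) \<times> (nat \<Rightarrow> 'b)) \<Rightarrow> nat \<Rightarrow> ('f, 'r) formula \<Rightarrow> bool" where
  "agree M N p i \<phi> \<longleftrightarrow> (sat M (\<lambda>k. fst (p k) i) \<phi> \<longleftrightarrow> sat N (\<lambda>k. snd (p k) i) \<phi>)"

lemma agree_cong:
  assumes "\<And>k. k \<in> fv \<phi> \<Longrightarrow> p k = q k"
  shows "agree M N p i \<phi> = agree M N q i \<phi>"
  using sat_cong[of \<phi> "\<lambda>k. fst (p k) i" "\<lambda>k. fst (q k) i" M]
    sat_cong[of \<phi> "\<lambda>k. snd (p k) i" "\<lambda>k. snd (q k) i" N] assms
  by (simp add: agree_def)

text \<open>The pairs in \<open>P\<close> form a finite approximation to an isomorphism of ultrapowers.  Assignments are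
  injective on the relevant variables so that a new pair is the value of at most one of them.\<close>

definition consistent :: "('f, 'r) language \<Rightarrow> ('f, 'r, 'a) fo_structure \<Rightarrow>
    ('f, 'r, 'b) fo_structure \<Rightarrow> ((nat \<Rightarrow> 'a) \<times> (nat \<Rightarrow> 'b)) set \<Rightarrow> bool" where
  "consistent L M N P \<longleftrightarrow> (\<forall>\<Phi> V p. finite \<Phi> \<longrightarrow> finite V \<longrightarrow>
     (\<forall>\<phi> \<in> \<Phi>. wf_formula L \<phi> \<and> fv \<phi> \<subseteq> V) \<longrightarrow> inj_on p V \<longrightarrow> p ` V \<subseteq> P \<longrightarrow>
     infinite {i. \<forall>\<phi> \<in> \<Phi>. agree M N p i \<phi>})"

lemma consistentD:
  assumes "consistent L M N P" "finite \<Phi>" "finite V" "\<And>\<phi>. \<phi> \<in> \<Phi> \<Longrightarrow> wf_formula L \<phi>"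
    "\<And>\<phi>. \<phi> \<in> \<Phi> \<Longrightarrow> fv \<phi> \<subseteq> V" "inj_on p V" "p ` V \<subseteq> P"
  shows "infinite {i. \<forall>\<phi> \<in> \<Phi>. agree M N p i \<phi>}"
  using assms unfolding consistent_def by blast

text \<open>This symmetry lets one extension lemma serve for both forth and back.\<close>

lemma consistent_converse:
  assumes "consistent L M N P"
  shows "consistent L N M (P\<inverse>)"
  unfolding consistent_def
proof (intro allI impI)
  fix \<Phi> V and p :: "nat \<Rightarrow> (nat \<Rightarrow> _) \<times> (nat \<Rightarrow> _)"
  assume *: "finite \<Phi>" "finite V" "\<forall>\<phi> \<in> \<Phi>. wf_formula L \<phi> \<and> fv \<phi> \<subseteq> V" "inj_on p V" "p ` V \<subseteq> P\<inverse>"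
  let ?q = "\<lambda>k. prod.swap (p k)"
  have "inj_on ?q V" using *(4) by (auto simp: inj_on_def prod.swap_def prod_eq_iff)
  moreover have "?q ` V \<subseteq> P" using *(5) by (auto simp: prod.swap_def)
  ultimately have "infinite {i. \<forall>\<phi> \<in> \<Phi>. agree M N ?q i \<phi>}"
    using * by (intro consistentD[OF assms, of \<Phi> V]) auto
  then show "infinite {i. \<forall>\<phi> \<in> \<Phi>. agree N M p i \<phi>}"
    by (simp add: agree_def eq_commute[of "sat M _ _"])
qed

lemma models_closed:
  assumes "is_structure L M" "fv \<phi> = {}"
  shows "models M \<phi> \<longleftrightarrow> sat M v \<phi>"
proof -
  obtain a where "a \<in> universe M" using assms(1) by (auto simp: is_structure_def)
  then have "range (\<lambda>_ :: nat. a) \<subseteq> universe M" by auto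
  moreover have "sat M w \<phi> = sat M v \<phi>" for w
    by (rule sat_cong) (simp add: assms(2))
  ultimately show ?thesis unfolding models_def by blast
qed

text \<open>Without pairs to assign, \<open>V\<close> is empty and the formulas are sentences;
  elementary equivalence makes them agree at every index.\<close>

lemma consistent_empty:
  fixes M :: "('f, 'r, 'a) fo_structure" and N :: "('f, 'r, 'b) fo_structure"
  assumes "is_structure L M" "is_structure L N" "elem_equiv L M N"
  shows "consistent L M N {}"
  unfolding consistent_def
proof (intro allI impI)
  fix \<Phi> V and p :: "nat \<Rightarrow> (nat \<Rightarrow> 'a) \<times> (nat \<Rightarrow> 'b)"
  assume *: "\<forall>\<phi> \<in> \<Phi>. wf_formula L \<phi> \<and> fv \<phi> \<subseteq> V" "p ` V \<subseteq> {}"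
  have "agree M N p i \<phi>" if "\<phi> \<in> \<Phi>" for i \<phi>
  proof -
    have "wf_formula L \<phi>" "fv \<phi> = {}" using * that by auto
    then show ?thesis
      using assms(3) models_closed[OF assms(1)] models_closed[OF assms(2)]
      by (auto simp: agree_def elem_equiv_def sentence_def)
  qed
  then show "infinite {i. \<forall>\<phi> \<in> \<Phi>. agree M N p i \<phi>}" by simp
qed

text \<open>The truth pattern that \<open>f i\<close> realizes in \<open>M\<close> is described by
  an existential formula about the old pairs. There are finitely many possible patterns, so
  consistency makes all these formulas agree at infinitely many \<open>i\<close>; there
  \<open>N\<close> realizes the same pattern, with a witness in \<open>H\<close>. The new partner
  may be a constant sequence because only its \<open>i\<close>-th entry is read.\<close>

lemma infinite_realizable:
  assumes cons: "consistent L M N P" and wc: "witness_closed L N H"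
    and PH: "\<And>f' g'. (f', g') \<in> P \<Longrightarrow> range g' \<subseteq> H" and f: "range f \<subseteq> universe M"
    and V: "finite V" "inj_on r V" "r ` V \<subseteq> P"
    and \<Phi>: "\<And>\<phi>. \<phi> \<in> set \<Phi> \<Longrightarrow> wf_formula L \<phi>" "\<And>\<phi>. \<phi> \<in> set \<Phi> \<Longrightarrow> fv \<phi> \<subseteq> insert k V"
    and k: "k \<notin> V"
  shows "infinite {i. \<exists>b \<in> H. \<forall>\<phi> \<in> set \<Phi>. agree M N (r(k := (f, \<lambda>_. b))) i \<phi>}"
proof -
  \<comment> \<open>These lists include every choice of a sign for each member of
    \<open>\<Phi>\<close>, and there are only finitely many of them.\<close>
  define \<Psi> where "\<Psi> = (\<lambda>\<phi>s. Exi k (conj_list k \<phi>s)) `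
    {\<phi>s. set \<phi>s \<subseteq> set \<Phi> \<union> Neg ` set \<Phi> \<and> length \<phi>s = length \<Phi>}"
  have "infinite {i. \<forall>\<psi> \<in> \<Psi>. agree M N r i \<psi>}"
  proof (rule consistentD[OF cons _ V(1) _ _ V(2,3)])
    show "finite \<Psi>" unfolding \<Psi>_def by (intro finite_imageI finite_lists_length_eq) auto
    show "wf_formula L \<psi>" if "\<psi> \<in> \<Psi>" for \<psi>
      using that \<Phi>(1) by (fastforce simp: \<Psi>_def wf_conj_list)
    show "fv \<psi> \<subseteq> V" if "\<psi> \<in> \<Psi>" for \<psi>
      using that \<Phi>(2) by (fastforce simp: \<Psi>_def fv_conj_list)
  qed
  moreover have "\<exists>b \<in> H. \<forall>\<phi> \<in> set \<Phi>. agree M N (r(k := (f, \<lambda>_. b))) i \<phi>"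
    if i: "\<forall>\<psi> \<in> \<Psi>. agree M N r i \<psi>" for i
  proof -
    let ?v = "\<lambda>j. fst (r j) i" and ?w = "\<lambda>j. snd (r j) i"
    \<comment> \<open>The pattern actually realized by \<open>f i\<close> at this index.\<close>
    define \<phi>s where "\<phi>s = map (\<lambda>\<phi>. if sat M (?v(k := f i)) \<phi> then \<phi> else Neg \<phi>) \<Phi>"
    have "Exi k (conj_list k \<phi>s) \<in> \<Psi>"
      unfolding \<Psi>_def by (rule imageI) (auto simp: \<phi>s_def)
    then have ag: "agree M N r i (Exi k (conj_list k \<phi>s))" using i by blast
    have "sat M (?v(k := f i)) (conj_list k \<phi>s)"
      by (auto simp: sat_conj_list \<phi>s_def)
    then have "sat M ?v (Exi k (conj_list k \<phi>s))" using f by auto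
    then have "sat N ?w (Exi k (conj_list k \<phi>s))" using ag unfolding agree_def by blast
    moreover have "wf_formula L (conj_list k \<phi>s)"
      using \<Phi>(1) by (auto simp: wf_conj_list \<phi>s_def)
    moreover have "?w ` (fv (conj_list k \<phi>s) - {k}) \<subseteq> H"
    proof -
      have "fv (conj_list k \<phi>s) - {k} \<subseteq> V"
        using \<Phi>(2) by (fastforce simp: fv_conj_list \<phi>s_def split: if_splits)
      moreover have "snd (r j) i \<in> H" if "j \<in> V" for j
        using PH[of "fst (r j)" "snd (r j)"] V(3) that by auto
      ultimately show ?thesis by blast
    qed
    ultimately obtain b where b: "b \<in> H" "sat N (?w(k := b)) (conj_list k \<phi>s)"
      using wc unfolding witness_closed_def by blast
    have "agree M N (r(k := (f, \<lambda>_. b))) i \<phi>" if "\<phi> \<in> set \<Phi>" for \<phi>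
    proof -
      have "(\<lambda>j. fst ((r(k := (f, \<lambda>_. b))) j) i) = ?v(k := f i)"
        "(\<lambda>j. snd ((r(k := (f, \<lambda>_. b))) j) i) = ?w(k := b)" by auto
      moreover have "sat N (?w(k := b)) (if sat M (?v(k := f i)) \<phi> then \<phi> else Neg \<phi>)"
        using b(2) that by (auto simp: sat_conj_list \<phi>s_def)
      ultimately show ?thesis unfolding agree_def by (auto split: if_splits)
    qed
    then show ?thesis using b(1) by blast
  qed
  ultimately show ?thesis by (elim infinite_super[rotated]) blast
qed

text \<open>A requirement consists of finitely many formulas, a variable for the new pair and a
  finite assignment of old pairs. The reals whose coded sequence violates it form a meagre set, and
  there are fewer than continuum many requirements, so one real meets them all.\<close>

lemma consistent_extend:
  fixes L :: "('f, 'r) language" and M :: "('f, 'r, 'a) fo_structure"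
    and N :: "('f, 'r, 'b) fo_structure"
  assumes cov: "cov_meagre =o continuum" and L: "countable_language L"
    and cons: "consistent L M N P" and small: "|P| <o continuum"
    and H: "countable H" "H \<noteq> {}" "witness_closed L N H"
    and PH: "\<And>f' g'. (f', g') \<in> P \<Longrightarrow> range g' \<subseteq> H" and f: "range f \<subseteq> universe M"
  shows "\<exists>g. range g \<subseteq> H \<and> consistent L M N (insert (f, g) P)"
proof -
  \<comment> \<open>\<open>e\<close> enumerates \<open>H\<close>, with repetitions if
    \<open>H\<close> is finite, and turns the code of a real into a sequence \<open>G x\<close> in
    \<open>H\<close>.\<close>
  define e where "e = from_nat_into H"
  have e: "range e = H" using range_from_nat_into[OF H(2,1)] by (simp add: e_def)
  define G where "G x i = e (code x i)" for x i
  define r :: "(nat \<times> (nat \<Rightarrow> 'a) \<times> (nat \<Rightarrow> 'b)) list \<Rightarrow> _" where "r pl j = the (map_of pl j)" for pl j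
  \<comment> \<open>Requirements are encoded by lists so that they can be counted: \<open>pl\<close>
    is the assignment of old pairs, and \<open>k\<close> is reserved for the new one.\<close>
  define I where "I = {(\<Phi>, k, pl). set \<Phi> \<subseteq> {\<phi>. wf_formula L \<phi>} \<and>
    (\<forall>\<phi> \<in> set \<Phi>. fv \<phi> \<subseteq> insert k (fst ` set pl)) \<and> k \<notin> fst ` set pl \<and>
    inj_on (r pl) (fst ` set pl) \<and> snd ` set pl \<subseteq> P}"
  define B where "B = (\<lambda>(\<Phi>, k, pl).
    {x. finite {i. \<forall>\<phi> \<in> set \<Phi>. agree M N ((r pl)(k := (f, G x))) i \<phi>}})"
  have "|I| <o continuum"
  proof -
    let ?s = "|P <+> (UNIV :: nat set)|"
    have s: "Cinfinite ?s" by (simp add: cinfinite_def Field_card_of card_of_card_order_on)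
    have "I \<subseteq> lists {\<phi>. wf_formula L \<phi>} \<times> UNIV \<times> lists (UNIV \<times> P)"
      unfolding I_def by (auto simp: in_lists_conv_set)
    moreover have "|lists {\<phi>. wf_formula L \<phi>} \<times> (UNIV :: nat set) \<times> lists ((UNIV :: nat set) \<times> P)| \<le>o ?s"
      using s countable_wf_formula[OF L]
      by (intro card_of_Times_ordLeq_infinite_Field card_of_lists_bound countable_ordLeq_Cinfinite
          card_of_Plus1 s) (auto simp: cinfinite_def)
    ultimately have "|I| \<le>o ?s" by (meson card_of_mono1 ordLeq_transitive)
    then show ?thesis using card_of_Plus_nat_less_continuum[OF small] by (rule ordLeq_ordLess_trans)
  qed
  moreover have "meagre (B z)" if "z \<in> I" for z
  proof -
    obtain \<Phi> k pl where z: "z = (\<Phi>, k, pl)" by (cases z)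
    \<comment> \<open>The codes of suitable values at \<open>i\<close>; by
      \<open>infinite_realizable\<close> some exist for infinitely many \<open>i\<close>.\<close>
    define T where "T i = {t. \<forall>\<phi> \<in> set \<Phi>. agree M N ((r pl)(k := (f, \<lambda>_. e t))) i \<phi>}" for i
    have I: "set \<Phi> \<subseteq> {\<phi>. wf_formula L \<phi>}" "\<forall>\<phi> \<in> set \<Phi>. fv \<phi> \<subseteq> insert k (fst ` set pl)"
      "k \<notin> fst ` set pl" "inj_on (r pl) (fst ` set pl)" "snd ` set pl \<subseteq> P"
      using that by (auto simp: I_def z)
    have "r pl ` fst ` set pl \<subseteq> P"
    proof
      fix y assume "y \<in> r pl ` fst ` set pl"
      then obtain j where j: "j \<in> fst ` set pl" "y = r pl j" by blast
      then obtain y' where "map_of pl j = Some y'" by (metis domIff dom_map_of_conv_image_fst not_None_eq)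
      then have "(j, y) \<in> set pl" using j by (simp add: r_def map_of_SomeD)
      then show "y \<in> P" using I(5) by force
    qed
    then have "infinite {i. \<exists>b \<in> H. \<forall>\<phi> \<in> set \<Phi>. agree M N ((r pl)(k := (f, \<lambda>_. b))) i \<phi>}"
      using I by (intro infinite_realizable[OF cons H(3) PH f, where V = "fst ` set pl"]) auto
    then have "infinite {i. T i \<noteq> {}}"
      unfolding T_def e[symmetric] by simp
    then have "meagre {x. finite {i. code x i \<in> T i}}" by (rule meagre_code)
    moreover have "code x i \<in> T i \<longleftrightarrow> (\<forall>\<phi> \<in> set \<Phi>. agree M N ((r pl)(k := (f, G x))) i \<phi>)" for x i
    proof -
      have "(\<lambda>j. snd (((r pl)(k := (f, \<lambda>_. e (code x i)))) j) i) = (\<lambda>j. snd (((r pl)(k := (f, G x))) j) i)"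
        "(\<lambda>j. fst (((r pl)(k := (f, \<lambda>_. e (code x i)))) j) i) = (\<lambda>j. fst (((r pl)(k := (f, G x))) j) i)"
        by (auto simp: G_def)
      then show ?thesis by (simp only: T_def agree_def mem_Collect_eq)
    qed
    ultimately show ?thesis by (simp add: B_def z)
  qed
  ultimately obtain x where x: "\<forall>z \<in> I. x \<notin> B z" using meagre_family_avoided[OF cov] by blast
  have "consistent L M N (insert (f, G x) P)"
    unfolding consistent_def
  proof (intro allI impI)
    fix \<Phi> V and p :: "nat \<Rightarrow> (nat \<Rightarrow> 'a) \<times> (nat \<Rightarrow> 'b)"
    assume *: "finite \<Phi>" "finite V" "\<forall>\<phi> \<in> \<Phi>. wf_formula L \<phi> \<and> fv \<phi> \<subseteq> V" "inj_on p V"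
      "p ` V \<subseteq> insert (f, G x) P"
    show "infinite {i. \<forall>\<phi> \<in> \<Phi>. agree M N p i \<phi>}"
    proof (cases "(f, G x) \<in> p ` V")
      case False
      then show ?thesis using * by (intro consistentD[OF cons, of \<Phi> V]) auto
    next
      case True
      \<comment> \<open>As \<open>p\<close> is injective, \<open>k\<close> is the only variable
        assigned the new pair, so all others take values in \<open>P\<close> and one of the
        requirements in \<open>I\<close> applies.\<close>
      then obtain k where k: "k \<in> V" "p k = (f, G x)" by auto
      obtain \<Phi>l where \<Phi>l: "set \<Phi>l = \<Phi>" using *(1) finite_list by blast
      define pl where "pl = map (\<lambda>j. (j, p j)) (sorted_list_of_set (V - {k}))"
      have r: "r pl j = p j" if "j \<in> V" "j \<noteq> k" for j
        using that *(2) by (simp add: pl_def r_def map_of_map_restrict)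
      have pl: "fst ` set pl = V - {k}" using *(2) by (force simp: pl_def)
      have "p j \<in> P" if "j \<in> V" "j \<noteq> k" for j
        using *(4,5) that k by (metis image_subset_iff inj_on_eq_iff insertE)
      moreover have "snd ` set pl = p ` (V - {k})" using *(2) by (force simp: pl_def)
      ultimately have "snd ` set pl \<subseteq> P" by auto
      moreover have "inj_on (r pl) (fst ` set pl)"
        unfolding pl using *(4) r by (auto simp: inj_on_def)
      moreover have "\<forall>\<phi> \<in> set \<Phi>l. fv \<phi> \<subseteq> insert k (fst ` set pl)" "set \<Phi>l \<subseteq> {\<phi>. wf_formula L \<phi>}"
        "k \<notin> fst ` set pl"
        unfolding pl using *(3) \<Phi>l by auto
      ultimately have "(\<Phi>l, k, pl) \<in> I" by (simp add: I_def)
      then have inf: "infinite {i. \<forall>\<phi> \<in> \<Phi>. agree M N ((r pl)(k := (f, G x))) i \<phi>}"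
        using x by (auto simp: B_def \<Phi>l)
      have "agree M N ((r pl)(k := (f, G x))) i \<phi> = agree M N p i \<phi>" if "\<phi> \<in> \<Phi>" for i \<phi>
        by (rule agree_cong) (use *(3) that k r in auto)
      then show ?thesis using inf by simp
    qed
  qed
  moreover have "range (G x) \<subseteq> H" using e by (auto simp: G_def)
  ultimately show ?thesis by blast
qed

section \<open>From a total consistent family to an isomorphism\<close>

text \<open>Smaller filters have more sets, so Zorn's lemma is applied downwards. A minimal proper
  filter decides every \<open>P\<close>: if it lacks the complement of \<open>P\<close>, adjoining
  \<open>P\<close> keeps it proper and hence changes nothing.\<close>

lemma ultrafilter_below:
  assumes "F \<noteq> (bot :: 'i filter)"
  shows "\<exists>U. ultrafilter U \<and> U \<le> F"
proof -
  let ?A = "{G. G \<noteq> bot \<and> G \<le> F}"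
  have "\<exists>U \<in> ?A. \<forall>G \<in> ?A. G \<le> U \<longrightarrow> G = U"
  proof (rule predicate_Zorn[where P = "\<lambda>x y. y \<le> x"])
    show "partial_order_on ?A (relation_of (\<lambda>x y. y \<le> x) ?A)"
      by (auto simp: partial_order_on_def preorder_on_def refl_on_def trans_def antisym_def relation_of_def)
    fix C assume C: "C \<in> Chains (relation_of (\<lambda>x y. y \<le> x) ?A)"
    have CA: "C \<subseteq> ?A" using C by (auto simp: Chains_def relation_of_def)
    have tot: "G \<le> H \<or> H \<le> G" if "G \<in> C" "H \<in> C" for G H
      using C that by (auto simp: Chains_def relation_of_def)
    \<comment> \<open>Inserting \<open>F\<close> covers the empty chain and keeps the infimum below
      \<open>F\<close>.\<close>
    have fin: "\<exists>G \<in> insert F C. G \<le> Inf X" if "finite X" "X \<subseteq> insert F C" for X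
      using that
    proof (induction X)
      case (insert H X)
      then obtain G where G: "G \<in> insert F C" "G \<le> Inf X" by auto
      have "G \<le> H \<or> H \<le> G" using tot[of G H] G(1) insert.prems CA by auto
      then show ?case
      proof
        assume "G \<le> H"
        then show ?thesis using G by (intro bexI[of _ G]) auto
      next
        assume "H \<le> G"
        then show ?thesis using G insert.prems by (intro bexI[of _ H]) (auto intro: order_trans)
      qed
    qed auto
    have "Inf (insert F C) \<noteq> bot"
    proof (rule Inf_filter_not_bot)
      fix X assume "X \<subseteq> insert F C" "finite X"
      then obtain G where "G \<in> insert F C" "G \<le> Inf X" using fin by blast
      moreover from this have "G \<noteq> bot" using CA assms by auto
      ultimately show "Inf X \<noteq> bot" by (metis bot_unique)
    qed
    moreover have "Inf (insert F C) \<le> G" if "G \<in> insert F C" for G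
      using that by (rule Inf_lower)
    ultimately show "\<exists>U \<in> ?A. \<forall>G \<in> C. U \<le> G"
      by (intro bexI[of _ "Inf (insert F C)"]) auto
  qed
  then obtain U where U: "U \<noteq> bot" "U \<le> F"
    and min: "\<And>G. G \<noteq> bot \<Longrightarrow> G \<le> F \<Longrightarrow> G \<le> U \<Longrightarrow> G = U" by blast
  have "eventually P U \<or> eventually (\<lambda>i. \<not> P i) U" for P
  proof (rule disjCI)
    assume *: "\<not> eventually (\<lambda>i. \<not> P i) U"
    let ?G = "inf U (principal {i. P i})"
    have "?G \<noteq> bot"
      using * by (simp add: trivial_limit_def eventually_inf_principal)
    then have "?G = U" using U(2) by (intro min) (auto intro: le_infI1)
    moreover have "eventually P ?G" by (simp add: eventually_inf_principal)
    ultimately show "eventually P U" by simp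
  qed
  then show ?thesis using U by (auto simp: ultrafilter_def)
qed

text \<open>Here the assignments vary with the formula and need not be injective. All pairs that
  occur are put in one list without repetition, and each variable is renamed to the position of its
  pair; a single injective assignment then serves all formulas.\<close>

lemma consistent_atomic:
  assumes cons: "consistent L M N P" and "finite S"
    and S: "\<And>\<phi> p. (\<phi>, p) \<in> S \<Longrightarrow> atomic \<phi> \<and> wf_formula L \<phi> \<and> p ` fv \<phi> \<subseteq> P"
  shows "\<exists>i. \<forall>(\<phi>, p) \<in> S. agree M N p i \<phi>"
proof -
  define E where "E = (\<Union>(\<phi>, p) \<in> S. p ` fv \<phi>)"
  have "finite E" using \<open>finite S\<close> finite_fv by (auto simp: E_def)
  then obtain es where es: "set es = E" "distinct es" using finite_distinct_list by blast
  define e where "e k = es ! k" for k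
  define \<rho> where "\<rho> x = (SOME k. k < length es \<and> es ! k = x)" for x
  have \<rho>: "\<rho> x < length es \<and> es ! \<rho> x = x" if "x \<in> E" for x
    unfolding \<rho>_def by (rule someI_ex) (use that es(1) in \<open>auto simp: in_set_conv_nth\<close>)
  let ?\<Phi> = "(\<lambda>(\<phi>, p). ren_atom (\<lambda>k. \<rho> (p k)) \<phi>) ` S"
  have pE: "p k \<in> E" if "(\<phi>, p) \<in> S" "k \<in> fv \<phi>" for \<phi> p k
    using that by (auto simp: E_def)
  have "infinite {i. \<forall>\<psi> \<in> ?\<Phi>. agree M N e i \<psi>}"
  proof (rule consistentD[OF cons, of _ "{..<length es}"])
    fix \<psi> assume "\<psi> \<in> ?\<Phi>"
    then obtain \<phi> p where \<phi>: "(\<phi>, p) \<in> S" "\<psi> = ren_atom (\<lambda>k. \<rho> (p k)) \<phi>" by auto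
    show "wf_formula L \<psi>" using S[OF \<phi>(1)] \<phi>(2) wf_ren_atom by blast
    show "fv \<psi> \<subseteq> {..<length es}"
      using S[OF \<phi>(1)] \<phi>(2) \<rho>[OF pE[OF \<phi>(1)]] by (auto simp: fv_ren_atom)
  next
    show "inj_on e {..<length es}" using es(2) by (auto simp: inj_on_def e_def nth_eq_iff_index_eq)
    have "E \<subseteq> P" using S by (auto simp: E_def)
    then show "e ` {..<length es} \<subseteq> P" using es(1) by (auto simp: e_def)
  qed (use \<open>finite S\<close> in auto)
  then obtain i where i: "\<forall>\<psi> \<in> ?\<Phi>. agree M N e i \<psi>"
    using not_finite_existsD by (metis (mono_tags, lifting))
  have "agree M N p i \<phi>" if "(\<phi>, p) \<in> S" for \<phi> p
  proof -
    have "agree M N e i (ren_atom (\<lambda>k. \<rho> (p k)) \<phi>)" using i that by auto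
    then have "agree M N (\<lambda>k. e (\<rho> (p k))) i \<phi>"
      using S[OF that] by (simp add: agree_def sat_ren_atom)
    moreover have "agree M N (\<lambda>k. e (\<rho> (p k))) i \<phi> = agree M N p i \<phi>"
      by (rule agree_cong) (use \<rho> pE[OF that] in \<open>auto simp: e_def\<close>)
    ultimately show ?thesis by simp
  qed
  then show ?thesis by blast
qed

text \<open>By \<open>consistent_atomic\<close> the agreement sets have the finite intersection
  property, so they generate a proper filter, which some ultrafilter extends.\<close>

lemma consistent_ultrafilter:
  assumes "consistent L M N P"
  shows "\<exists>U. ultrafilter U \<and> (\<forall>\<phi> p. atomic \<phi> \<longrightarrow> wf_formula L \<phi> \<longrightarrow> p ` fv \<phi> \<subseteq> P \<longrightarrow>
    eventually (\<lambda>i. agree M N p i \<phi>) U)"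
proof -
  define S where "S = {(\<phi>, p). atomic \<phi> \<and> wf_formula L \<phi> \<and> p ` fv \<phi> \<subseteq> P}"
  define A where "A = (\<lambda>(\<phi>, p). {i. agree M N p i \<phi>})"
  have "(INF z \<in> S. principal (A z)) \<noteq> bot"
  proof (rule INF_filter_not_bot)
    fix X assume X: "X \<subseteq> S" "finite X"
    then have "\<exists>i. \<forall>(\<phi>, p) \<in> X. agree M N p i \<phi>"
      by (intro consistent_atomic[OF assms]) (auto simp: S_def)
    then have "(\<Inter>z \<in> X. A z) \<noteq> {}" by (auto simp: A_def)
    then show "(INF z \<in> X. principal (A z)) \<noteq> bot"
      using X(2) by (simp add: INF_principal_finite principal_eq_bot_iff)
  qed
  then obtain U where U: "ultrafilter U" "U \<le> (INF z \<in> S. principal (A z))"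
    using ultrafilter_below by blast
  have "eventually (\<lambda>i. agree M N p i \<phi>) U" if "(\<phi>, p) \<in> S" for \<phi> p
  proof -
    have "U \<le> principal (A (\<phi>, p))" using U(2) that by (meson INF_lower order_trans)
    then show ?thesis by (simp add: le_principal A_def)
  qed
  then show ?thesis using U(1) by (auto simp: S_def)
qed

lemma eventually_iff_cong:
  assumes "eventually (\<lambda>i. P i \<longleftrightarrow> Q i) F"
  shows "eventually P F \<longleftrightarrow> eventually Q F"
proof
  assume "eventually P F" with assms show "eventually Q F" by eventually_elim simp
next
  assume "eventually Q F" with assms show "eventually P F" by eventually_elim simp
qed

text \<open>The class of \<open>f\<close> is sent to the class of any partner \<open>g\<close>.
  Agreement on equations and relation atoms makes this a well-defined embedding; partners for
  sequences in \<open>N\<close> make it onto.\<close>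

lemma isomorphic_ultrapowers:
  fixes L :: "('f, 'r) language" and M :: "('f, 'r, 'a) fo_structure"
    and N :: "('f, 'r, 'b) fo_structure"
  assumes M: "is_structure L M" and N: "is_structure L N" and cons: "consistent L M N P"
    and dom: "\<And>f. range f \<subseteq> universe M \<Longrightarrow> \<exists>g. range g \<subseteq> universe N \<and> (f, g) \<in> P"
    and ran: "\<And>g. range g \<subseteq> universe N \<Longrightarrow> \<exists>f. range f \<subseteq> universe M \<and> (f, g) \<in> P"
  shows "\<exists>U :: nat filter. ultrafilter U \<and> isomorphic L (ultrapower U M) (ultrapower U N)"
proof -
  obtain U where U: "ultrafilter U" and ag: "\<And>\<phi> p. atomic \<phi> \<Longrightarrow> wf_formula L \<phi> \<Longrightarrow> p ` fv \<phi> \<subseteq> P \<Longrightarrow>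
    eventually (\<lambda>i. agree M N p i \<phi>) U"
    using consistent_ultrafilter[OF cons] by blast
  define cM cN where "cM f = ultrapower_rel U (universe M) `` {f}"
    and "cN g = ultrapower_rel U (universe N) `` {g}" for f g
  let ?XM = "UNIV \<rightarrow> universe M :: (nat \<Rightarrow> 'a) set" and ?XN = "UNIV \<rightarrow> universe N :: (nat \<Rightarrow> 'b) set"
  have cM_eq: "cM f = cM f' \<longleftrightarrow> eventually (\<lambda>i. f i = f' i) U" if "f \<in> ?XM" "f' \<in> ?XM" for f f'
    unfolding cM_def eq_equiv_class_iff[OF equiv_ultrapower_rel that]
    using that by (simp add: ultrapower_rel_def)
  have cN_eq: "cN g = cN g' \<longleftrightarrow> eventually (\<lambda>i. g i = g' i) U" if "g \<in> ?XN" "g' \<in> ?XN" for g g'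
    unfolding cN_def eq_equiv_class_iff[OF equiv_ultrapower_rel that]
    using that by (simp add: ultrapower_rel_def)
  have uM: "universe (ultrapower U M) = cM ` ?XM" and uN: "universe (ultrapower U N) = cN ` ?XN"
    by (auto simp: ultrapower_def quotient_def cM_def cN_def)
  \<comment> \<open>From left to right this makes the map independent of representatives and
    partners, from right to left injective.\<close>
  have same: "eventually (\<lambda>i. f i = f' i) U \<longleftrightarrow> eventually (\<lambda>i. g i = g' i) U"
    if "(f, g) \<in> P" "(f', g') \<in> P" for f g f' g'
  proof -
    have "eventually (\<lambda>i. agree M N (\<lambda>k. if k = 0 then (f, g) else (f', g')) i (Eq (Var 0) (Var 1))) U"
      by (rule ag) (use that in auto)
    then have *: "eventually (\<lambda>i. f i = f' i \<longleftrightarrow> g i = g' i) U" by (simp add: agree_def)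
    show ?thesis by (rule eventually_iff_cong[OF *])
  qed
  have "\<forall>f \<in> ?XM. \<exists>g. g \<in> ?XN \<and> (f, g) \<in> P"
    using dom by (metis PiE_UNIV_domain Pi_I Pi_mem UNIV_I image_subset_iff)
  then obtain \<sigma> where \<sigma>: "\<And>f. f \<in> ?XM \<Longrightarrow> \<sigma> f \<in> ?XN" "\<And>f. f \<in> ?XM \<Longrightarrow> (f, \<sigma> f) \<in> P"
    by metis
  define h where "h = (\<lambda>X. cN (\<sigma> (SOME f. f \<in> ?XM \<and> cM f = X)))"
  have h: "h (cM f) = cN g" if "f \<in> ?XM" "g \<in> ?XN" "(f, g) \<in> P" for f g
  proof -
    define f' where "f' = (SOME f'. f' \<in> ?XM \<and> cM f' = cM f)"
    have f': "f' \<in> ?XM" "cM f' = cM f"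
      unfolding f'_def using someI_ex[of "\<lambda>f'. f' \<in> ?XM \<and> cM f' = cM f"] that(1) by auto
    then have "eventually (\<lambda>i. f' i = f i) U" using cM_eq that(1) by simp
    then have "eventually (\<lambda>i. \<sigma> f' i = g i) U" using same[OF \<sigma>(2) that(3)] f' by blast
    then have "cN (\<sigma> f') = cN g" using cN_eq \<sigma>(1) f' that(2) by blast
    then show ?thesis by (simp add: h_def f'_def)
  qed
  have h\<sigma>: "h (cM f) = cN (\<sigma> f)" if "f \<in> ?XM" for f using h \<sigma> that by blast
  have "bij_betw h (universe (ultrapower U M)) (universe (ultrapower U N))"
    unfolding bij_betw_def
  proof
    show "inj_on h (universe (ultrapower U M))"
    proof (rule inj_onI)
      fix X Y assume "X \<in> universe (ultrapower U M)" "Y \<in> universe (ultrapower U M)" and eq: "h X = h Y"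
      then obtain f f' where f: "f \<in> ?XM" "f' \<in> ?XM" "X = cM f" "Y = cM f'" unfolding uM by blast
      have "eventually (\<lambda>i. \<sigma> f i = \<sigma> f' i) U"
        using eq f cN_eq \<sigma>(1) h\<sigma> by simp
      then show "X = Y" using same[OF \<sigma>(2)[OF f(1)] \<sigma>(2)[OF f(2)]] f cM_eq by simp
    qed
    show "h ` universe (ultrapower U M) = universe (ultrapower U N)"
    proof
      show "h ` universe (ultrapower U M) \<subseteq> universe (ultrapower U N)"
        unfolding uM uN using h\<sigma> \<sigma>(1) by auto
      show "universe (ultrapower U N) \<subseteq> h ` universe (ultrapower U M)"
      proof
        fix Y assume "Y \<in> universe (ultrapower U N)"
        then obtain g where g: "g \<in> ?XN" "Y = cN g" unfolding uN by blast
        then obtain f where "range f \<subseteq> universe M" "(f, g) \<in> P" using ran[of g] by auto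
        then have "h (cM f) = Y" "f \<in> ?XM" using h[of f g] g by auto
        then show "Y \<in> h ` universe (ultrapower U M)" unfolding uM by blast
      qed
    qed
  qed
  moreover have repr: "\<exists>hs. set hs \<subseteq> ?XM \<and> xs = map cM hs" if "set xs \<subseteq> universe (ultrapower U M)" for xs
  proof -
    have "xs \<in> lists (cM ` ?XM)" using that uM by auto
    then show ?thesis unfolding lists_image by auto
  qed
  moreover have "h (fun_int (ultrapower U M) F xs) = fun_int (ultrapower U N) F (map h xs)"
    if F: "F \<in> funs L" and xs: "length xs = fun_ar L F" "set xs \<subseteq> universe (ultrapower U M)" for F xs
  proof -
    obtain hs where hs: "set hs \<subseteq> ?XM" "xs = map cM hs" using repr[OF xs(2)] by blast
    let ?gs = "map \<sigma> hs"
    have gs: "set ?gs \<subseteq> ?XN" using \<sigma>(1) hs(1) by auto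
    have len: "length hs = fun_ar L F" "length ?gs = fun_ar L F" using xs(1) hs(2) by auto
    have map_h: "map h xs = map cN ?gs" using hs h\<sigma> by auto
    define f g where "f i = fun_int M F (map (\<lambda>h. h i) hs)"
      and "g i = fun_int N F (map (\<lambda>h. h i) ?gs)" for i
    have f: "f \<in> ?XM" unfolding f_def by (rule fun_int_pointwise[OF M F len(1) hs(1)])
    have g: "g \<in> ?XN" unfolding g_def by (rule fun_int_pointwise[OF N F len(2) gs])
    have "fun_int (ultrapower U M) F xs = cM f"
      unfolding hs(2) cM_def f_def by (rule fun_int_ultrapower[OF M F len(1) hs(1)])
    moreover have "fun_int (ultrapower U N) F (map h xs) = cN g"
      unfolding map_h cN_def g_def by (rule fun_int_ultrapower[OF N F len(2) gs])
    moreover have "cN (\<sigma> f) = cN g"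
    proof -
      \<comment> \<open>The arguments occupy the first variables and their value \<open>f\<close>
        the next one. The equation \<open>?\<phi>\<close> holds in \<open>M\<close> at every index,
        hence in \<open>N\<close> at almost every index, so \<open>\<sigma> f\<close> is almost
        everywhere the value at the partners.\<close>
      define p where "p k = (if k < length hs then (hs ! k, \<sigma> (hs ! k)) else (f, \<sigma> f))" for k
      let ?\<phi> = "Eq (Var (length hs)) (Fun F (map Var [0..<length hs]))"
      have "p k \<in> P" for k
        using \<sigma>(2) f hs(1) by (auto simp: p_def dest!: nth_mem)
      then have "eventually (\<lambda>i. agree M N p i ?\<phi>) U"
        by (intro ag) (use F len in auto)
      moreover have "map (\<lambda>k. fst (p k) i) [0..<length hs] = map (\<lambda>h. h i) hs"
        "map (\<lambda>k. snd (p k) i) [0..<length hs] = map (\<lambda>h. h i) ?gs" for i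
        by (auto intro!: nth_equalityI simp: p_def)
      then have "agree M N p i ?\<phi> \<longleftrightarrow> (f i = f i \<longleftrightarrow> \<sigma> f i = g i)" for i
        by (simp add: agree_def comp_def f_def g_def) (simp add: p_def f_def)
      ultimately show ?thesis using cN_eq[OF \<sigma>(1)[OF f] g] by simp
    qed
    ultimately show ?thesis using h\<sigma>[OF f] by simp
  qed
  moreover have "rel_int (ultrapower U M) R xs \<longleftrightarrow> rel_int (ultrapower U N) R (map h xs)"
    if R: "R \<in> rels L" and xs: "length xs = rel_ar L R" "set xs \<subseteq> universe (ultrapower U M)" for R xs
  proof -
    obtain hs where hs: "set hs \<subseteq> ?XM" "xs = map cM hs" using repr[OF xs(2)] by blast
    let ?gs = "map \<sigma> hs"
    have gs: "set ?gs \<subseteq> ?XN" using \<sigma>(1) hs(1) by auto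
    have map_h: "map h xs = map cN ?gs" using hs h\<sigma> by auto
    \<comment> \<open>The default is never read: \<open>?\<phi>\<close> has only variables below
      \<open>length hs\<close>.\<close>
    define p where "p k = (if k < length hs then (hs ! k, \<sigma> (hs ! k)) else undefined)" for k
    let ?\<phi> = "Rel R (map Var [0..<length hs])"
    have "p k \<in> P" if "k < length hs" for k
      using \<sigma>(2) hs(1) that by (auto simp: p_def dest!: nth_mem)
    then have "eventually (\<lambda>i. agree M N p i ?\<phi>) U"
      by (intro ag) (use R xs(1) hs(2) in auto)
    moreover have "map (\<lambda>k. fst (p k) i) [0..<length hs] = map (\<lambda>h. h i) hs"
      "map (\<lambda>k. snd (p k) i) [0..<length hs] = map (\<lambda>h. h i) ?gs" for i
      by (auto intro!: nth_equalityI simp: p_def)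
    then have "agree M N p i ?\<phi> \<longleftrightarrow> (rel_int M R (map (\<lambda>h. h i) hs) \<longleftrightarrow> rel_int N R (map (\<lambda>h. h i) ?gs))" for i
      by (simp add: agree_def comp_def)
    ultimately have ev: "eventually (\<lambda>i. rel_int M R (map (\<lambda>h. h i) hs) \<longleftrightarrow> rel_int N R (map (\<lambda>h. h i) ?gs)) U"
      by simp
    have "rel_int (ultrapower U M) R xs \<longleftrightarrow> eventually (\<lambda>i. rel_int M R (map (\<lambda>h. h i) hs)) U"
      unfolding hs(2) cM_def by (rule rel_int_ultrapower[OF hs(1)])
    also have "\<dots> \<longleftrightarrow> eventually (\<lambda>i. rel_int N R (map (\<lambda>h. h i) ?gs)) U"
      by (rule eventually_iff_cong[OF ev])
    also have "\<dots> \<longleftrightarrow> rel_int (ultrapower U N) R (map h xs)"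
      unfolding map_h cN_def by (rule rel_int_ultrapower[OF gs, symmetric])
    finally show ?thesis .
  qed
  ultimately have "isomorphic L (ultrapower U M) (ultrapower U N)"
    unfolding isomorphic_def by (intro exI[of _ h]) simp
  then show ?thesis using U by blast
qed

section \<open>Ordering the tasks in blocks\<close>

lemma Card_order_aleph1: "Card_order aleph1"
  by (rule cardSuc_Card_order[OF natLeq_Card_order])

lemma aleph1_total:
  assumes "i \<in> Field aleph1" "j \<in> Field aleph1"
  shows "(i, j) \<in> aleph1 \<or> (j, i) \<in> aleph1"
proof -
  have "Well_order aleph1" using Card_order_aleph1 by (simp add: card_order_on_def)
  then have "Refl aleph1" "Total aleph1" by (auto simp: order_on_defs)
  then show ?thesis using assms by (cases "i = j") (auto simp: refl_on_def total_on_def)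
qed

lemma aleph1_refl: "i \<in> Field aleph1 \<Longrightarrow> (i, i) \<in> aleph1"
  using aleph1_total[of i i] by simp

lemma trans_aleph1: "trans aleph1"
proof -
  have "Well_order aleph1" using Card_order_aleph1 by (simp add: card_order_on_def)
  then show ?thesis by (auto simp: order_on_defs)
qed

lemma aleph1_trans: "(i, j) \<in> aleph1 \<Longrightarrow> (j, k) \<in> aleph1 \<Longrightarrow> (i, k) \<in> aleph1"
  by (rule transD[OF trans_aleph1])

lemma countable_under_aleph1: "countable (under aleph1 i)"
proof (cases "i \<in> Field aleph1")
  case True
  have "|underS aleph1 i| <o aleph1" by (rule card_of_underS[OF Card_order_aleph1 True])
  then have "|underS aleph1 i| \<le>o natLeq"
    using cardSuc_ordLeq_ordLess[OF natLeq_Card_order card_of_Card_order] by blast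
  then have "|underS aleph1 i| \<le>o |UNIV :: nat set|"
    using ordIso_symmetric[OF card_of_nat] by (rule ordLeq_ordIso_trans)
  then have "countable (underS aleph1 i)"
    unfolding countable_def card_of_ordLeq[symmetric] by blast
  moreover have "under aleph1 i \<subseteq> insert i (underS aleph1 i)" by (auto simp: under_def underS_def)
  ultimately show ?thesis by (rule countable_subset[rotated, OF countable_insert])
next
  case False
  then have "under aleph1 i = {}" by (auto simp: under_def Field_def)
  then show ?thesis by simp
qed

text \<open>Enumerate the universe along \<open>aleph1\<close> and take hulls of initial segments,
  which are countable. Since \<open>aleph1\<close> is regular, the countable range of a sequence is
  absorbed by one hull.\<close>

lemma countable_hull_chain:
  fixes L :: "('f, 'r) language" and M :: "('f, 'r, 'a) fo_structure"
  assumes "is_structure L M" "countable_language L" "|universe M| =o aleph1"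
  shows "\<exists>H. (\<forall>i j. (i, j) \<in> aleph1 \<longrightarrow> H i \<subseteq> H j) \<and>
    (\<forall>i \<in> Field aleph1. countable (H i) \<and> H i \<noteq> {} \<and> H i \<subseteq> universe M \<and> witness_closed L M (H i)) \<and>
    (\<forall>f :: nat \<Rightarrow> 'a. range f \<subseteq> universe M \<longrightarrow> (\<exists>i \<in> Field aleph1. range f \<subseteq> H i))"
proof -
  have "|Field aleph1| =o |universe M|"
    using card_of_Field_ordIso[OF Card_order_aleph1] assms(3)
    by (meson ordIso_symmetric ordIso_transitive)
  then obtain m where m: "bij_betw m (Field aleph1) (universe M)"
    unfolding card_of_ordIso[symmetric] by blast
  define H where "H i = skolem_hull L M (m ` under aleph1 i)" for i
  have mono: "H i \<subseteq> H j" if "(i, j) \<in> aleph1" for i j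
    unfolding H_def
    by (rule skolem_hull_mono) (use that in \<open>auto simp: under_def intro: aleph1_trans\<close>)
  have "m ` under aleph1 i \<subseteq> universe M" for i
    using m by (auto simp: under_def bij_betw_def Field_def)
  then have sub: "H i \<subseteq> universe M" for i
    unfolding H_def by (rule skolem_hull_subset[OF assms(1)])
  have mem: "m i \<in> H i" if "i \<in> Field aleph1" for i
    unfolding H_def by (rule skolem_hull.base) (use that in \<open>auto simp: under_def aleph1_refl\<close>)
  have bounded: "\<exists>i \<in> Field aleph1. range f \<subseteq> H i" if "range f \<subseteq> universe M" for f :: "nat \<Rightarrow> 'a"
  proof (rule cardSuc_UNION[OF natLeq_Card_order])
    show "infinite (Field natLeq)" by (simp add: Field_natLeq)
    show "relChain aleph1 H" using mono by (simp add: relChain_def)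
    show "range f \<subseteq> (\<Union>i \<in> Field aleph1. H i)"
    proof
      fix x assume "x \<in> range f"
      then have "x \<in> m ` Field aleph1" using that m by (auto simp: bij_betw_def)
      then show "x \<in> (\<Union>i \<in> Field aleph1. H i)" using mem by blast
    qed
    show "|range f| \<le>o natLeq"
      by (rule countable_ordLeq_Cinfinite[OF natLeq_Cinfinite]) simp
  qed
  have cou: "countable (H i)" for i
    unfolding H_def
    by (intro countable_skolem_hull assms countable_image countable_under_aleph1)
  have wit: "witness_closed L M (H i)" for i
    unfolding H_def by (rule witness_closed_skolem_hull[OF assms(1)])
  show ?thesis
    by (intro exI[of _ H] conjI allI ballI impI mono cou sub wit bounded) (use mem in auto)
qed

text \<open>With \<open>X\<close> embedded in the binary sequences, a sequence in \<open>X\<close>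
  becomes countably many binary sequences, which the pairing function merges into one.\<close>

lemma surj_sequences:
  fixes X :: "'a set"
  assumes "|X| \<le>o continuum" "X \<noteq> {}"
  shows "\<exists>F :: (nat \<Rightarrow> bool) \<Rightarrow> nat \<Rightarrow> 'a. range F = {f. range f \<subseteq> X}"
proof -
  obtain e :: "'a \<Rightarrow> nat \<Rightarrow> bool" where e: "inj_on e X"
    using assms(1) unfolding continuum_eq card_of_ordLeq[symmetric] by auto
  define c where "c f n = e (f (fst (prod_decode n))) (snd (prod_decode n))" for f n
  have "inj_on c {f. range f \<subseteq> X}"
  proof (rule inj_onI)
    fix f g assume fg: "f \<in> {f. range f \<subseteq> X}" "g \<in> {f. range f \<subseteq> X}" and eq: "c f = c g"
    have "e (f i) j = e (g i) j" for i j
      using fun_cong[OF eq, of "prod_encode (i, j)"] by (simp add: c_def)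
    then have "e (f i) = e (g i)" for i by blast
    then show "f = g" using e fg by (auto simp: inj_on_def image_subset_iff)
  qed
  then have le: "|{f :: nat \<Rightarrow> 'a. range f \<subseteq> X}| \<le>o |UNIV :: (nat \<Rightarrow> bool) set|"
    unfolding card_of_ordLeq[symmetric] by (intro exI[of _ c]) simp
  obtain x where "x \<in> X" using assms(2) by blast
  then have "(\<lambda>_ :: nat. x) \<in> {f. range f \<subseteq> X}" by auto
  then have "{f :: nat \<Rightarrow> 'a. range f \<subseteq> X} \<noteq> {}" by blast
  from card_of_ordLeq2[OF this] le show ?thesis by (rule iffD2)
qed

text \<open>Within block \<open>i\<close> only sequences in the \<open>i\<close>-th countable hull are treated, and only those
  whose number lies below the \<open>i\<close>-th term of a cofinal sequence or an earlier one.  This bounds the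
  number of predecessors of a task: countably many terms of the cofinal sequence are bounded.\<close>

lemma task_order:
  fixes c :: "(nat \<Rightarrow> bool) \<Rightarrow> nat set"
  assumes cf: "cofinality continuum =o aleph1" and c: "\<And>\<alpha>. c \<alpha> \<in> Field aleph1"
  obtains idx R where "wf R" "trans R" "\<And>\<alpha> \<beta>. \<alpha> \<noteq> \<beta> \<Longrightarrow> (\<alpha>, \<beta>) \<in> R \<or> (\<beta>, \<alpha>) \<in> R"
    "\<And>\<alpha>. idx \<alpha> \<in> Field aleph1" "\<And>\<alpha>. (c \<alpha>, idx \<alpha>) \<in> aleph1"
    "\<And>\<alpha>. |{\<beta>. (\<beta>, \<alpha>) \<in> R}| <o continuum"
    "\<And>\<alpha> \<beta>. (\<beta>, \<alpha>) \<in> R \<Longrightarrow> (idx \<beta>, idx \<alpha>) \<in> aleph1"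
proof -
  let ?C = continuum and ?W = aleph1
  have CC: "Card_order ?C" by (rule Card_order_continuum)
  have fC: "Field ?C = UNIV" by (simp add: continuum_eq Field_card_of)
  have wC: "Well_order ?C" using CC by (simp add: card_order_on_def)
  have wW: "Well_order ?W" using Card_order_aleph1 by (simp add: card_order_on_def)
  have infC: "infinite (Field ?C)"
    using nat_less_continuum unfolding fC unfolding continuum_eq
    by (meson card_of_ordLeq_infinite infinite_UNIV_nat ordLess_imp_ordLeq)
  let ?F = "{A. A \<subseteq> Field ?C \<and> cofinal A ?C}"
  have "Field ?C \<in> ?F"
    using infinite_Card_order_limit[OF CC infC] by (auto simp: cofinal_def)
  then have "?F \<noteq> {}" by blast
  from min_card_iff[OF this Card_order_aleph1] cf
  obtain A where A: "cofinal A ?C" "|A| =o ?W" and min: "\<And>B. cofinal B ?C \<Longrightarrow> ?W \<le>o |B|"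
    unfolding cofinality_def fC by auto
  have "|Field ?W| =o |A|"
    using card_of_Field_ordIso[OF Card_order_aleph1] A(2) by (meson ordIso_symmetric ordIso_transitive)
  then obtain a where a: "bij_betw a (Field ?W) A" unfolding card_of_ordIso[symmetric] by blast
  \<comment> \<open>\<open>k \<alpha>\<close> will index a term of the cofinal sequence
    \<open>a\<close> that lies strictly above \<open>\<alpha>\<close>.\<close>
  have "\<exists>k \<in> Field ?W. \<alpha> \<noteq> a k \<and> (\<alpha>, a k) \<in> ?C" for \<alpha>
    using A(1) a fC unfolding cofinal_def bij_betw_def by blast
  then obtain k where k: "\<And>\<alpha>. k \<alpha> \<in> Field ?W" "\<And>\<alpha>. \<alpha> \<noteq> a (k \<alpha>)" "\<And>\<alpha>. (\<alpha>, a (k \<alpha>)) \<in> ?C" by metis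
  have "\<exists>i \<in> Field ?W. (c \<alpha>, i) \<in> ?W \<and> (k \<alpha>, i) \<in> ?W" for \<alpha>
    using aleph1_total[OF c k(1)] aleph1_refl c k(1) by blast
  then obtain idx where idx: "\<And>\<alpha>. idx \<alpha> \<in> Field ?W" "\<And>\<alpha>. (c \<alpha>, idx \<alpha>) \<in> ?W" "\<And>\<alpha>. (k \<alpha>, idx \<alpha>) \<in> ?W"
    by metis
  \<comment> \<open>Tasks are ordered by block first, and within a block by the well-order of the
    continuum.\<close>
  define R where "R = inv_image ((?W - Id) <*lex*> (?C - Id)) (\<lambda>\<alpha>. (idx \<alpha>, \<alpha>))"
  have R_wf: "wf R"
    unfolding R_def using wC wW by (intro wf_inv_image wf_lex_prod) (auto simp: well_order_on_def)
  have R_trans: "trans R"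
    unfolding R_def using wC wW
    by (intro trans_inv_image trans_lex_prod trans_diff_Id) (auto simp: order_on_defs)
  have R_total: "\<alpha> \<noteq> \<beta> \<longrightarrow> (\<alpha>, \<beta>) \<in> R \<or> (\<beta>, \<alpha>) \<in> R" for \<alpha> \<beta>
  proof -
    have "Total ?C" using wC by (simp add: order_on_defs)
    then show ?thesis
      using aleph1_total[OF idx(1) idx(1), of \<alpha> \<beta>] fC by (auto simp: R_def total_on_def)
  qed
  have R_idx: "(idx \<beta>, idx \<alpha>) \<in> ?W" if "(\<beta>, \<alpha>) \<in> R" for \<alpha> \<beta>
    using that idx(1) aleph1_refl by (auto simp: R_def)
  have R_small: "|{\<beta>. (\<beta>, \<alpha>) \<in> R}| <o ?C" for \<alpha>
  proof -
    let ?U = "under ?W (idx \<alpha>)"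
    have "|a ` ?U| \<le>o natLeq"
      by (rule countable_ordLeq_Cinfinite[OF natLeq_Cinfinite])
        (intro countable_image countable_under_aleph1)
    then have "|a ` ?U| <o ?W"
      using cardSuc_greater[OF natLeq_Card_order] by (rule ordLeq_ordLess_trans)
    then have "\<not> cofinal (a ` ?U) ?C" using min not_ordLess_ordLeq by blast
    then obtain \<gamma> where \<gamma>: "\<And>j. j \<in> ?U \<Longrightarrow> \<not> (\<gamma> \<noteq> a j \<and> (\<gamma>, a j) \<in> ?C)"
      unfolding cofinal_def by blast
    have "{\<beta>. (\<beta>, \<alpha>) \<in> R} \<subseteq> underS ?C \<gamma>"
    proof
      fix \<beta> assume "\<beta> \<in> {\<beta>. (\<beta>, \<alpha>) \<in> R}"
      then have "k \<beta> \<in> ?U" using R_idx idx(3) by (auto simp: under_def intro: aleph1_trans)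
      from \<gamma>[OF this] have "(a (k \<beta>), \<gamma>) \<in> ?C"
        using wC fC by (cases "\<gamma> = a (k \<beta>)") (auto simp: order_on_defs refl_on_def total_on_def)
      moreover have "trans ?C" "antisym ?C" using wC by (auto simp: order_on_defs)
      ultimately have "(\<beta>, \<gamma>) \<in> ?C" "\<beta> \<noteq> \<gamma>"
        using k(2,3)[of \<beta>] by (meson transD antisymD)+
      then show "\<beta> \<in> underS ?C \<gamma>" by (simp add: underS_def)
    qed
    then show ?thesis
      by (rule ordLeq_ordLess_trans[OF card_of_mono1]) (simp add: card_of_underS[OF CC] fC)
  qed
  show ?thesis
    by (rule that[OF R_wf R_trans _ idx(1,2) R_small R_idx]) (use R_total in simp)
qed

section \<open>The transfinite construction\<close>

lemma consistent_mono:
  assumes "consistent L M N Q" "P \<subseteq> Q"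
  shows "consistent L M N P"
  unfolding consistent_def
proof (intro allI impI)
  fix \<Phi> V and p :: "nat \<Rightarrow> (nat \<Rightarrow> _) \<times> (nat \<Rightarrow> _)"
  assume *: "finite \<Phi>" "finite V" "\<forall>\<phi> \<in> \<Phi>. wf_formula L \<phi> \<and> fv \<phi> \<subseteq> V" "inj_on p V" "p ` V \<subseteq> P"
  show "infinite {i. \<forall>\<phi> \<in> \<Phi>. agree M N p i \<phi>}"
    by (rule consistentD[OF assms(1), of \<Phi> V]) (use * assms(2) in auto)
qed

lemma consistent_finite_character:
  assumes "\<And>X. finite X \<Longrightarrow> X \<subseteq> P \<Longrightarrow> consistent L M N X"
  shows "consistent L M N P"
  unfolding consistent_def
proof (intro allI impI)
  fix \<Phi> V and p :: "nat \<Rightarrow> (nat \<Rightarrow> _) \<times> (nat \<Rightarrow> _)"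
  assume *: "finite \<Phi>" "finite V" "\<forall>\<phi> \<in> \<Phi>. wf_formula L \<phi> \<and> fv \<phi> \<subseteq> V" "inj_on p V" "p ` V \<subseteq> P"
  have "consistent L M N (p ` V)" using *(2,5) by (intro assms) auto
  then show "infinite {i. \<forall>\<phi> \<in> \<Phi>. agree M N p i \<phi>}"
    by (rule consistentD[of L M N "p ` V" \<Phi> V]) (use * in auto)
qed

text \<open>Recursion that chooses a value suitable for the union of the earlier ones. Existence of
  such a value remains a premise, because it can be proved only by induction on the choices already
  made.\<close>

lemma wf_rec_choice:
  assumes "wf R"
  obtains h where "\<And>\<alpha> Z. Q (\<Union>\<beta> \<in> {\<beta>. (\<beta>, \<alpha>) \<in> R}. h \<beta>) \<alpha> Z \<Longrightarrow>
    Q (\<Union>\<beta> \<in> {\<beta>. (\<beta>, \<alpha>) \<in> R}. h \<beta>) \<alpha> (h \<alpha>)"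
proof -
  define G where "G h \<alpha> = (SOME Z. Q (\<Union>\<beta> \<in> {\<beta>. (\<beta>, \<alpha>) \<in> R}. h \<beta>) \<alpha> Z)" for h \<alpha>
  define h where "h = wfrec R G"
  have h: "h \<alpha> = G h \<alpha>" for \<alpha>
  proof -
    have "h \<alpha> = G (cut h R \<alpha>) \<alpha>" unfolding h_def by (rule wfrec[OF assms])
    also have "\<dots> = G h \<alpha>" by (simp add: G_def cut_apply)
    finally show ?thesis .
  qed
  have "Q (\<Union>\<beta> \<in> {\<beta>. (\<beta>, \<alpha>) \<in> R}. h \<beta>) \<alpha> (h \<alpha>)"
    if "Q (\<Union>\<beta> \<in> {\<beta>. (\<beta>, \<alpha>) \<in> R}. h \<beta>) \<alpha> Z" for \<alpha> Z
  proof -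
    have "Q (\<Union>\<beta> \<in> {\<beta>. (\<beta>, \<alpha>) \<in> R}. h \<beta>) \<alpha> (G h \<alpha>)"
      unfolding G_def by (rule someI[where P = "Q _ \<alpha>"]) (rule that)
    then show ?thesis by (simp only: h[symmetric])
  qed
  then show ?thesis by (rule that)
qed

lemma finite_bounded_by_member:
  assumes "trans R" "\<And>\<alpha> \<beta>. \<alpha> \<noteq> \<beta> \<Longrightarrow> (\<alpha>, \<beta>) \<in> R \<or> (\<beta>, \<alpha>) \<in> R" "finite B" "B \<noteq> {}"
  shows "\<exists>\<beta> \<in> B. \<forall>\<gamma> \<in> B. \<gamma> = \<beta> \<or> (\<gamma>, \<beta>) \<in> R"
  using assms(3,4)
proof (induction B rule: finite_ne_induct)
  case (insert x B)
  then obtain \<beta> where \<beta>: "\<beta> \<in> B" "\<forall>\<gamma> \<in> B. \<gamma> = \<beta> \<or> (\<gamma>, \<beta>) \<in> R" by blast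
  show ?case
  proof (cases "x = \<beta> \<or> (x, \<beta>) \<in> R")
    case True
    then show ?thesis using \<beta> by auto
  next
    case False
    then have "(\<beta>, x) \<in> R" using assms(2) by blast
    then have "\<gamma> = x \<or> (\<gamma>, x) \<in> R" if "\<gamma> \<in> insert x B" for \<gamma>
      using that \<beta>(2) assms(1) by (auto dest: transD)
    then show ?thesis by blast
  qed
qed simp

lemma card_of_insert_less_continuum:
  assumes "|X| <o continuum"
  shows "|insert x X| <o continuum"
proof -
  have "|X \<union> {x}| \<le>o |X <+> {x}|" by (rule card_of_Un_Plus_ordLeq)
  moreover have "|X <+> {x}| \<le>o |X <+> (UNIV :: nat set)|"
    by (rule card_of_Plus_mono2[OF card_of_singl_ordLeq]) simp
  ultimately have "|X \<union> {x}| <o continuum"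
    using card_of_Plus_nat_less_continuum[OF assms] by (meson ordLeq_ordLess_trans)
  then show ?thesis by simp
qed

lemma card_of_converse: "|X\<inverse>| \<le>o |X|"
proof -
  have "X\<inverse> = prod.swap ` X" by force
  then show ?thesis by (simp only: card_of_image)
qed

theorem theorem1p2:
  fixes L :: "('f, 'r) language"
    and M :: "('f, 'r, 'a) fo_structure"
    and N :: "('f, 'r, 'b) fo_structure"
  assumes "aleph1 <o continuum"
    and "cofinality continuum =o aleph1"
    and "cov_meagre =o continuum"
    and "countable_language L"
    and "is_structure L M" and "is_structure L N"
    and "|universe M| =o aleph1" and "|universe N| =o aleph1"
    and "elem_equiv L M N"
  shows "\<exists>U :: nat filter. ultrafilter U \<and> isomorphic L (ultrapower U M) (ultrapower U N)"
proof -
  note cov = assms(3) and L = assms(4) and M = assms(5) and N = assms(6)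
  obtain HM where HM_mono: "\<And>i j. (i, j) \<in> aleph1 \<Longrightarrow> HM i \<subseteq> HM j"
    and HM: "\<And>i. i \<in> Field aleph1 \<Longrightarrow>
      countable (HM i) \<and> HM i \<noteq> {} \<and> HM i \<subseteq> universe M \<and> witness_closed L M (HM i)"
    and HM_range: "\<And>f :: nat \<Rightarrow> 'a. range f \<subseteq> universe M \<Longrightarrow> \<exists>i \<in> Field aleph1. range f \<subseteq> HM i"
    using countable_hull_chain[OF M L assms(7)] by metis
  obtain HN where HN_mono: "\<And>i j. (i, j) \<in> aleph1 \<Longrightarrow> HN i \<subseteq> HN j"
    and HN: "\<And>i. i \<in> Field aleph1 \<Longrightarrow>
      countable (HN i) \<and> HN i \<noteq> {} \<and> HN i \<subseteq> universe N \<and> witness_closed L N (HN i)"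
    and HN_range: "\<And>f :: nat \<Rightarrow> 'b. range f \<subseteq> universe N \<Longrightarrow> \<exists>i \<in> Field aleph1. range f \<subseteq> HN i"
    using countable_hull_chain[OF N L assms(8)] by metis
  have le: "aleph1 \<le>o continuum" using assms(1) by (rule ordLess_imp_ordLeq)
  \<comment> \<open>A binary sequence \<open>\<alpha>\<close> names a task: to provide partners for
    both \<open>F \<alpha>\<close> and \<open>G \<alpha>\<close>.\<close>
  obtain F :: "(nat \<Rightarrow> bool) \<Rightarrow> nat \<Rightarrow> 'a" where F: "range F = {f. range f \<subseteq> universe M}"
    using surj_sequences[OF ordIso_ordLeq_trans[OF assms(7) le]] M unfolding is_structure_def by blast
  obtain G :: "(nat \<Rightarrow> bool) \<Rightarrow> nat \<Rightarrow> 'b" where G: "range G = {f. range f \<subseteq> universe N}"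
    using surj_sequences[OF ordIso_ordLeq_trans[OF assms(8) le]] N unfolding is_structure_def by blast
  have FG_universe: "range (F \<alpha>) \<subseteq> universe M" "range (G \<alpha>) \<subseteq> universe N" for \<alpha>
    using F G by blast+
  have "\<exists>i \<in> Field aleph1. range (F \<alpha>) \<subseteq> HM i \<and> range (G \<alpha>) \<subseteq> HN i" for \<alpha>
  proof -
    obtain i where i: "i \<in> Field aleph1" "range (F \<alpha>) \<subseteq> HM i" using HM_range[OF FG_universe(1)] by blast
    obtain j where j: "j \<in> Field aleph1" "range (G \<alpha>) \<subseteq> HN j" using HN_range[OF FG_universe(2)] by blast
    from aleph1_total[OF i(1) j(1)] show ?thesis
      using i j HM_mono[of i j] HN_mono[of j i] by (elim disjE) (meson order_trans)+
  qed
  then obtain c where c: "\<And>\<alpha>. c \<alpha> \<in> Field aleph1" "\<And>\<alpha>. range (F \<alpha>) \<subseteq> HM (c \<alpha>)"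
    "\<And>\<alpha>. range (G \<alpha>) \<subseteq> HN (c \<alpha>)" by metis
  obtain idx R where wf: "wf R" and tr: "trans R"
    and tot: "\<And>\<alpha> \<beta>. \<alpha> \<noteq> \<beta> \<Longrightarrow> (\<alpha>, \<beta>) \<in> R \<or> (\<beta>, \<alpha>) \<in> R"
    and idx: "\<And>\<alpha>. idx \<alpha> \<in> Field aleph1" "\<And>\<alpha>. (c \<alpha>, idx \<alpha>) \<in> aleph1"
    and small: "\<And>\<alpha>. |{\<beta>. (\<beta>, \<alpha>) \<in> R}| <o continuum"
    and idx_mono: "\<And>\<alpha> \<beta>. (\<beta>, \<alpha>) \<in> R \<Longrightarrow> (idx \<beta>, idx \<alpha>) \<in> aleph1"
    by (rule task_order[OF assms(2) c(1)]; rule that)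
  have F_idx: "range (F \<alpha>) \<subseteq> HM (idx \<alpha>)" and G_idx: "range (G \<alpha>) \<subseteq> HN (idx \<alpha>)" for \<alpha>
    using c(2,3)[of \<alpha>] HM_mono[OF idx(2)] HN_mono[OF idx(2)] by (meson order_trans)+
  \<comment> \<open>\<open>Z\<close> is the set of pairs added by task \<open>\<alpha>\<close> to
    the earlier pairs \<open>S\<close>. Its finiteness keeps the stages below the continuum, and its
    values stay in the hulls of the current block.\<close>
  define Q where "Q S \<alpha> Z \<longleftrightarrow> consistent L M N (S \<union> Z) \<and> finite Z \<and>
    (\<forall>(f, g) \<in> Z. range f \<subseteq> HM (idx \<alpha>) \<and> range g \<subseteq> HN (idx \<alpha>)) \<and>
    (\<exists>g. (F \<alpha>, g) \<in> Z) \<and> (\<exists>f. (f, G \<alpha>) \<in> Z)" for S \<alpha> Z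
  have QD: "consistent L M N (S \<union> Z)" "finite Z"
    "\<And>f g. (f, g) \<in> Z \<Longrightarrow> range f \<subseteq> HM (idx \<alpha>)" "\<And>f g. (f, g) \<in> Z \<Longrightarrow> range g \<subseteq> HN (idx \<alpha>)"
    "\<exists>g. (F \<alpha>, g) \<in> Z" "\<exists>f. (f, G \<alpha>) \<in> Z" if "Q S \<alpha> Z" for S \<alpha> Z
    using that unfolding Q_def by blast+
  obtain h where h: "\<And>\<alpha> Z. Q (\<Union>\<beta> \<in> {\<beta>. (\<beta>, \<alpha>) \<in> R}. h \<beta>) \<alpha> Z \<Longrightarrow>
      Q (\<Union>\<beta> \<in> {\<beta>. (\<beta>, \<alpha>) \<in> R}. h \<beta>) \<alpha> (h \<alpha>)"
    by (rule wf_rec_choice[OF wf, of Q]; rule that)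
  define S where "S \<alpha> = (\<Union>\<beta> \<in> {\<beta>. (\<beta>, \<alpha>) \<in> R}. h \<beta>)" for \<alpha>
  \<comment> \<open>Finitely many pairs come from finitely many tasks, and the \<open>R\<close>-last
    of these already ensures their joint consistency. This serves for the predecessors of a task and
    for the final union.\<close>
  have UN: "consistent L M N (\<Union>\<beta> \<in> D. h \<beta>)" if D: "\<And>\<beta>. \<beta> \<in> D \<Longrightarrow> Q (S \<beta>) \<beta> (h \<beta>)" for D
  proof (rule consistent_finite_character)
    fix X assume X: "finite X" "X \<subseteq> (\<Union>\<beta> \<in> D. h \<beta>)"
    then have "\<forall>x \<in> X. \<exists>\<beta> \<in> D. x \<in> h \<beta>" by blast
    then obtain b where b: "\<And>x. x \<in> X \<Longrightarrow> b x \<in> D \<and> x \<in> h (b x)" by metis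
    show "consistent L M N X"
    proof (cases "X = {}")
      case True
      then show ?thesis using consistent_empty[OF M N assms(9)] by simp
    next
      case False
      then obtain \<beta> where \<beta>: "\<beta> \<in> b ` X" "\<forall>\<gamma> \<in> b ` X. \<gamma> = \<beta> \<or> (\<gamma>, \<beta>) \<in> R"
        using finite_bounded_by_member[OF tr tot, of "b ` X"] X(1) by auto
      have "X \<subseteq> S \<beta> \<union> h \<beta>"
      proof
        fix x assume x: "x \<in> X"
        then have "b x = \<beta> \<or> (b x, \<beta>) \<in> R" "x \<in> h (b x)" using \<beta>(2) b by auto
        then show "x \<in> S \<beta> \<union> h \<beta>" unfolding S_def by auto
      qed
      moreover have "consistent L M N (S \<beta> \<union> h \<beta>)"
        using QD(1)[OF D] \<beta>(1) b by auto
      ultimately show ?thesis by (rule consistent_mono[rotated])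
    qed
  qed
  have Q: "Q (S \<alpha>) \<alpha> (h \<alpha>)" for \<alpha>
    using wf
  proof (induction \<alpha> rule: wf_induct_rule)
    case (less \<alpha>)
    have cons: "consistent L M N (S \<alpha>)"
      using UN[of "{\<beta>. (\<beta>, \<alpha>) \<in> R}"] less by (simp add: S_def[of \<alpha>])
    \<comment> \<open>Earlier tasks belong to the same or earlier blocks, whose hulls are contained
      in the current ones.\<close>
    have inH: "range f \<subseteq> HM (idx \<alpha>)" "range g \<subseteq> HN (idx \<alpha>)" if fg: "(f, g) \<in> S \<alpha>" for f g
    proof -
      obtain \<beta> where \<beta>: "(\<beta>, \<alpha>) \<in> R" "(f, g) \<in> h \<beta>" using fg by (auto simp: S_def)
      then have "range f \<subseteq> HM (idx \<beta>)" "range g \<subseteq> HN (idx \<beta>)"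
        using QD(3,4)[OF less] by auto
      then show "range f \<subseteq> HM (idx \<alpha>)" "range g \<subseteq> HN (idx \<alpha>)"
        using HM_mono[OF idx_mono[OF \<beta>(1)]] HN_mono[OF idx_mono[OF \<beta>(1)]] by (meson order_trans)+
    qed
    have card: "|S \<alpha>| <o continuum"
    proof -
      let ?s = "|{\<beta>. (\<beta>, \<alpha>) \<in> R} <+> (UNIV :: nat set)|"
      have s: "Cinfinite ?s" by (simp add: cinfinite_def Field_card_of card_of_card_order_on)
      have "countable (h \<beta>)" if "(\<beta>, \<alpha>) \<in> R" for \<beta>
        using QD(2)[OF less[OF that]] by (rule countable_finite)
      then have "|S \<alpha>| \<le>o ?s"
        unfolding S_def
        by (intro UNION_Cinfinite_bound card_of_Plus1 s ballI countable_ordLeq_Cinfinite[OF s]) simp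
      then show ?thesis
        using card_of_Plus_nat_less_continuum[OF small] by (rule ordLeq_ordLess_trans)
    qed
    have HMi: "countable (HM (idx \<alpha>))" "HM (idx \<alpha>) \<noteq> {}" "HM (idx \<alpha>) \<subseteq> universe M"
        "witness_closed L M (HM (idx \<alpha>))"
      and HNi: "countable (HN (idx \<alpha>))" "HN (idx \<alpha>) \<noteq> {}" "HN (idx \<alpha>) \<subseteq> universe N"
        "witness_closed L N (HN (idx \<alpha>))"
      using HM[OF idx(1)] HN[OF idx(1)] by blast+
    \<comment> \<open>Forth: a partner for \<open>F \<alpha>\<close> in the countable hull within
      \<open>N\<close>.\<close>
    have "\<exists>g. range g \<subseteq> HN (idx \<alpha>) \<and> consistent L M N (insert (F \<alpha>, g) (S \<alpha>))"
      by (rule consistent_extend[OF cov L cons card HNi(1,2,4) inH(2) FG_universe(1)])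
    then obtain g where g: "range g \<subseteq> HN (idx \<alpha>)" "consistent L M N (insert (F \<alpha>, g) (S \<alpha>))" by blast
    let ?P = "insert (F \<alpha>, g) (S \<alpha>)"
    have card': "|?P\<inverse>| <o continuum"
      by (rule ordLeq_ordLess_trans[OF card_of_converse card_of_insert_less_continuum[OF card]])
    \<comment> \<open>Back: the same extension with \<open>M\<close> and \<open>N\<close> exchanged,
      applied to the converse of the pairs that now include \<open>(F \<alpha>, g)\<close>.\<close>
    have "\<exists>f. range f \<subseteq> HM (idx \<alpha>) \<and> consistent L N M (insert (G \<alpha>, f) (?P\<inverse>))"
    proof (rule consistent_extend[OF cov L consistent_converse[OF g(2)] card' HMi(1,2,4)])
      show "range g' \<subseteq> HM (idx \<alpha>)" if "(f', g') \<in> ?P\<inverse>" for f' g'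
        using that F_idx[of \<alpha>] inH(1)[of g' f'] by (auto simp only: converse_iff insert_iff prod.inject)
      show "range (G \<alpha>) \<subseteq> universe N" by (rule FG_universe)
    qed
    then obtain f where f: "range f \<subseteq> HM (idx \<alpha>)" "consistent L N M (insert (G \<alpha>, f) (?P\<inverse>))" by blast
    have "(insert (G \<alpha>, f) (?P\<inverse>))\<inverse> = S \<alpha> \<union> {(F \<alpha>, g), (f, G \<alpha>)}" by auto
    then have "consistent L M N (S \<alpha> \<union> {(F \<alpha>, g), (f, G \<alpha>)})"
      using consistent_converse[OF f(2)] by simp
    then have "Q (S \<alpha>) \<alpha> {(F \<alpha>, g), (f, G \<alpha>)}"
      using F_idx[of \<alpha>] G_idx[of \<alpha>] f(1) g(1) by (auto simp: Q_def)
    then show ?case unfolding S_def by (rule h)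
  qed
  have P: "consistent L M N (\<Union>\<alpha>. h \<alpha>)" using UN[of UNIV] Q by simp
  have rng: "range f \<subseteq> universe M" "range g \<subseteq> universe N" if "(f, g) \<in> h \<alpha>" for f g \<alpha>
    using QD(3,4)[OF Q that] HM[OF idx(1), of \<alpha>] HN[OF idx(1), of \<alpha>] by auto
  show ?thesis
  proof (rule isomorphic_ultrapowers[OF M N P])
    show "\<exists>g. range g \<subseteq> universe N \<and> (f, g) \<in> (\<Union>\<alpha>. h \<alpha>)" if "range f \<subseteq> universe M" for f
    proof -
      have "f \<in> range F" using that by (simp add: F)
      then obtain \<alpha> where \<alpha>: "f = F \<alpha>" by blast
      obtain g where "(F \<alpha>, g) \<in> h \<alpha>" using QD(5)[OF Q, of \<alpha>] by blast
      then show ?thesis using rng(2)[of "F \<alpha>" g \<alpha>] \<alpha> by (intro exI[of _ g]) auto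
    qed
    show "\<exists>f. range f \<subseteq> universe M \<and> (f, g) \<in> (\<Union>\<alpha>. h \<alpha>)" if "range g \<subseteq> universe N" for g
    proof -
      have "g \<in> range G" using that by (simp add: G)
      then obtain \<alpha> where \<alpha>: "g = G \<alpha>" by blast
      obtain f where "(f, G \<alpha>) \<in> h \<alpha>" using QD(6)[OF Q, of \<alpha>] by blast
      then show ?thesis using rng(1)[of f "G \<alpha>" \<alpha>] \<alpha> by (intro exI[of _ f]) auto
    qed
  qed
qed

end
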